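(* Let $y_i$ ($i\in\mathbb{Z}$), $q_j$ ($j\ge1$) and $p_j$ ($j\ge1$) be independent indeterminates. Then the series $$\Phi:=\log\sum_{\lambda}\Big(\prod_{w\in\lambda}y_{c(w)}\Big)s_\lambda(q_1,q_2,\ldots)\,s_\lambda(p_1,p_2,\ldots),$$ where the sum is over all partitions $\lambda$ (including the empty partition), is a solution to the KP hierarchy in the variables $p_1,p_2,\ldots$.
   Context: A partition $\lambda=(\lambda_1,\ldots,\lambda_n)$ is a list of integers with $\lambda_1\ge\cdots\ge\lambda_n\ge1$. The Ferrers graph of $\lambda$ is the array of unit cells whose $i$th row from the top contains $\lambda_i$ cells, in columns $1,\ldots,\lambda_i$ from the left. The content of the cell $w$ in row $i$ and column $j$ is $c(w)=j-i$. Products over $w\in\lambda$ are over all cells of the Ferrers graph. Schur functions: $s_\lambda(p_1,p_2,\ldots)=\det(h_{\lambda_i-i+j})_{i,j=1,\ldots,n}$, where $\sum_{i\ge0}h_it^i=\exp\sum_{k\ge1}\frac{p_k}{k}t^k$ and $h_i=0$ for $i<0$ (so the $p_k$ play the role of power sums); similarly for $s_\lambda(q_1,q_2,\ldots)$. KP hierarchy (normalization $p_i=i\,x_i$, where $x_i$ are the standard KP times): let $K$ be a commutative $\mathbb{Q}$-algebra (here containing all the other indeterminates). A formal power series $F\in K[[p_1,p_2,\ldots]]$ with zero constant term is a solution to the KP hierarchy in the variables $p_1,p_2,\ldots$ if $\tau=e^F$ satisfies the bilinear identity $$[z^{-1}]\ \exp\Big(\sum_{i\ge1}\frac{p_i-p_i'}{i}z^i\Big)\,\tau(p_1-z^{-1},p_2-z^{-2},\ldots)\,\tau(p_1'+z^{-1},p_2'+z^{-2},\ldots)=0$$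 identically in two independent sets of variables $p_1,p_2,\ldots$ and $p_1',p_2',\ldots$, where $[z^{-1}]$ denotes the coefficient of $z^{-1}$. Equivalently, $F$ satisfies an infinite list of partial differential equations. The first is $F_{2,2}-F_{3,1}+\frac1{12}F_{1^4}+\frac12F_{1^2}^2=0$, where subscripts denote partial derivatives with respect to the corresponding $p_i$. *)

theory Defs
  imports
    "HOL-Library.Poly_Mapping"
    "HOL-Computational_Algebra.Formal_Laurent_Series"
    "Jordan_Normal_Form.Determinant"
begin

text \<open>A commutative ring carries at most one structure of \<open>\<rat>\<close>-algebra, and it carries one exactly
  if every positive integer is a unit.\<close>

class comm_rat_algebra = comm_ring_1 +
  assumes of_nat_dvd_one: "n > 0 \<Longrightarrow> of_nat n dvd 1"

definition recip :: "nat \<Rightarrow> 'a::comm_rat_algebra" where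
  "recip n = (THE x. of_nat n * x = 1)"

lemma of_nat_mult_recip:
  assumes "n > 0"
  shows "of_nat n * recip n = (1 :: 'a::comm_rat_algebra)"
proof -
  obtain x :: 'a where x: "of_nat n * x = 1"
    using of_nat_dvd_one[OF assms, where 'a = 'a] by (auto simp: dvd_def)
  have "y = x" if "of_nat n * y = 1" for y :: 'a
  proof -
    have "y = y * (of_nat n * x)"
      by (simp add: x)
    also have "\<dots> = of_nat n * y * x"
      by (simp only: mult_ac)
    finally show ?thesis
      by (simp add: that)
  qed
  then have "recip n = x"
    unfolding recip_def using x by (intro the_equality)
  then show ?thesis
    by (simp add: x)
qed

instance rat :: comm_rat_algebra
  by standard (simp add: dvd_field_iff)

instance poly_mapping :: (comm_monoid_add, comm_rat_algebra) comm_rat_algebra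
proof
  fix n :: nat
  assume "n > 0"
  then have "(of_nat n :: 'a \<Rightarrow>\<^sub>0 'b) * Poly_Mapping.single 0 (recip n) = 1"
    by (metis add_0 mult_single of_nat_mult_recip single_of_nat single_one)
  then show "(of_nat n :: 'a \<Rightarrow>\<^sub>0 'b) dvd 1"
    by (metis dvd_triv_left)
qed

instance fls :: (comm_rat_algebra) comm_rat_algebra
proof
  fix n :: nat
  assume "n > 0"
  then have "(of_nat n :: 'a fls) * fls_const (recip n) = 1"
    by (simp add: fls_of_nat of_nat_mult_recip)
  then show "(of_nat n :: 'a fls) dvd 1"
    by (metis dvd_triv_left)
qed


section \<open>Formal power series in arbitrarily many variables\<close>

text \<open>All formal power series over \<open>'a\<close> in variables indexed by \<open>'v\<close>; a monomial is its finitely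
  supported exponent vector.\<close>

typedef ('v, 'a) mps = "UNIV :: (('v \<Rightarrow>\<^sub>0 nat) \<Rightarrow> 'a) set"
  morphisms mps_coeff Abs_mps ..

lemma mps_coeff_Abs [simp]: "mps_coeff (Abs_mps f) = f"
  by (simp add: Abs_mps_inverse)

lemma mps_eqI: "(\<And>m. mps_coeff f m = mps_coeff g m) \<Longrightarrow> f = g"
  by (metis ext mps_coeff_inject)

definition splits :: "('v \<Rightarrow>\<^sub>0 nat) \<Rightarrow> (('v \<Rightarrow>\<^sub>0 nat) \<times> ('v \<Rightarrow>\<^sub>0 nat)) set" where
  "splits m = {(a, b). a + b = m}"

lemma finite_splits [simp]: "finite (splits m)"
proof -
  let ?F = "{f. \<forall>x. (x \<in> Poly_Mapping.keys m \<longrightarrow>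
                  f x \<in> {..Max (Poly_Mapping.lookup m ` Poly_Mapping.keys m)}) \<and>
                (x \<notin> Poly_Mapping.keys m \<longrightarrow> f x = (0::nat))}"
  have fin: "finite ?F"
    by (rule finite_set_of_finite_funs) auto
  have le: "Poly_Mapping.lookup a x \<le> Poly_Mapping.lookup (a + b) x" for a b :: "'a \<Rightarrow>\<^sub>0 nat" and x
    by (simp add: lookup_add)
  have sub: "Poly_Mapping.lookup a \<in> ?F" if "(a, b) \<in> splits m" for a b
  proof (clarsimp, intro conjI impI allI)
    fix x
    have *: "Poly_Mapping.lookup a x \<le> Poly_Mapping.lookup m x"
      using that le by (auto simp: splits_def)
    show "Poly_Mapping.lookup a x \<le> Max (Poly_Mapping.lookup m ` Poly_Mapping.keys m)" if "x \<in> Poly_Mapping.keys m"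
      by (rule order_trans[OF *]) (use that in auto)
    show "Poly_Mapping.lookup a x = 0" if "x \<notin> Poly_Mapping.keys m"
      using * that by (simp add: in_keys_iff)
  qed
  have "inj_on (Poly_Mapping.lookup \<circ> fst) (splits m)"
    by (auto simp: inj_on_def splits_def)
  moreover have "finite ((Poly_Mapping.lookup \<circ> fst) ` splits m)"
    by (rule finite_subset[OF _ fin]) (use sub in auto)
  ultimately show ?thesis
    by (rule finite_imageD[rotated])
qed

instantiation mps :: (type, comm_ring_1) comm_ring_1
begin

definition "0 = Abs_mps (\<lambda>_. 0)"
definition "1 = Abs_mps (\<lambda>m. if m = 0 then 1 else 0)"
definition "f + g = Abs_mps (\<lambda>m. mps_coeff f m + mps_coeff g m)"
definition "- f = Abs_mps (\<lambda>m. - mps_coeff f m)"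
definition "f - g = Abs_mps (\<lambda>m. mps_coeff f m - mps_coeff g m)"
definition "f * g = Abs_mps (\<lambda>m. \<Sum>(a, b)\<in>splits m. mps_coeff f a * mps_coeff g b)"

lemmas mps_ring_defs =
  zero_mps_def one_mps_def plus_mps_def uminus_mps_def minus_mps_def times_mps_def

instance
proof
  fix f g h :: "('a, 'b) mps"
  show "f * g * h = f * (g * h)"
  proof (rule mps_eqI)
    fix m
    have "mps_coeff (f * g * h) m =
        (\<Sum>(x, c)\<in>splits m. \<Sum>(a, b)\<in>splits x. mps_coeff f a * mps_coeff g b * mps_coeff h c)"
      by (simp add: times_mps_def sum_distrib_right case_prod_beta)
    also have "\<dots> = (\<Sum>((x, c), (a, b))\<in>(SIGMA w:splits m. splits (fst w)).
        mps_coeff f a * mps_coeff g b * mps_coeff h c)"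
      by (subst sum.Sigma[symmetric]) (auto simp: case_prod_beta)
    also have "\<dots> = (\<Sum>((a, y), (b, c))\<in>(SIGMA w:splits m. splits (snd w)).
        mps_coeff f a * mps_coeff g b * mps_coeff h c)"
      by (rule sum.reindex_bij_witness[where
            i = "\<lambda>((a, y), (b, c)). ((a + b, c), (a, b))" and
            j = "\<lambda>((x, c), (a, b)). ((a, b + c), (b, c))"])
         (auto simp: splits_def add.assoc)
    also have "\<dots> = (\<Sum>(a, y)\<in>splits m. \<Sum>(b, c)\<in>splits y. mps_coeff f a * mps_coeff g b * mps_coeff h c)"
      by (subst sum.Sigma[symmetric]) (auto simp: case_prod_beta)
    also have "\<dots> = mps_coeff (f * (g * h)) m"
      by (simp add: times_mps_def sum_distrib_left case_prod_beta mult.assoc)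
    finally show "mps_coeff (f * g * h) m = mps_coeff (f * (g * h)) m" .
  qed
  show "f * g = g * f"
  proof (rule mps_eqI)
    fix m
    show "mps_coeff (f * g) m = mps_coeff (g * f) m"
      unfolding times_mps_def mps_coeff_Abs
      by (rule sum.reindex_bij_witness[where i = prod.swap and j = prod.swap])
         (auto simp: splits_def add.commute mult.commute)
  qed
  show "1 * f = f"
  proof (rule mps_eqI)
    fix m
    have "mps_coeff (1 * f) m = (\<Sum>w\<in>splits m. if w = (0, m) then mps_coeff f m else 0)"
      unfolding times_mps_def one_mps_def mps_coeff_Abs
      by (rule sum.cong) (auto simp: splits_def split: if_splits)
    also have "\<dots> = mps_coeff f m"
      by (subst sum.delta[OF finite_splits]) (auto simp: splits_def)
    finally show "mps_coeff (1 * f) m = mps_coeff f m" .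
  qed
  show "(f + g) * h = f * h + g * h"
    by (rule mps_eqI) (simp add: plus_mps_def times_mps_def case_prod_beta distrib_right sum.distrib)
  show "(0 :: ('a, 'b) mps) \<noteq> 1"
  proof
    assume "(0 :: ('a, 'b) mps) = 1"
    then have "mps_coeff (0 :: ('a, 'b) mps) 0 = mps_coeff 1 0"
      by (rule arg_cong)
    then show False
      by (simp add: zero_mps_def one_mps_def)
  qed
qed (auto intro!: mps_eqI simp: mps_ring_defs add.assoc add.commute)

end

definition mps_const :: "'a::comm_ring_1 \<Rightarrow> ('v, 'a) mps" where
  "mps_const c = Abs_mps (\<lambda>m. if m = 0 then c else 0)"

definition mps_var :: "'v \<Rightarrow> ('v, 'a::comm_ring_1) mps" where
  "mps_var v = Abs_mps (\<lambda>m. if m = Poly_Mapping.single v 1 then 1 else 0)"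

lemma mps_const_mult_const: "mps_const a * mps_const b = mps_const (a * b)"
proof (rule mps_eqI)
  fix m :: "'v \<Rightarrow>\<^sub>0 nat"
  have "mps_coeff (mps_const a * mps_const b) m =
      (\<Sum>w\<in>splits m. if w = (0, 0) then a * b else 0)"
    unfolding times_mps_def mps_const_def mps_coeff_Abs by (rule sum.cong) (auto split: if_splits)
  also have "\<dots> = mps_coeff (mps_const (a * b)) m"
    by (subst sum.delta[OF finite_splits]) (auto simp: splits_def mps_const_def)
  finally show "mps_coeff (mps_const a * mps_const b) m = mps_coeff (mps_const (a * b)) m" .
qed

lemma mps_const_1 [simp]: "mps_const 1 = 1"
  by (simp add: mps_const_def one_mps_def)

lemma of_nat_mps: "of_nat n = mps_const (of_nat n)"
  by (induction n) (auto intro!: mps_eqI simp: mps_const_def mps_ring_defs)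

instance mps :: (type, comm_rat_algebra) comm_rat_algebra
proof
  fix n :: nat
  assume "n > 0"
  then have "(of_nat n :: ('a, 'b) mps) * mps_const (recip n) = 1"
    by (simp add: of_nat_mps mps_const_mult_const of_nat_mult_recip)
  then show "(of_nat n :: ('a, 'b) mps) dvd 1"
    by (metis dvd_triv_left)
qed

text \<open>The sum of a locally finite family of series, i.e. one in which every monomial has a nonzero
  coefficient in only finitely many members.  (For other families the value is meaningless, since
  a \<open>\<Sum>\<close> over an infinite set is \<open>0\<close>.)\<close>

definition mps_sum :: "('i \<Rightarrow> ('v, 'a::comm_ring_1) mps) \<Rightarrow> 'i set \<Rightarrow> ('v, 'a) mps" where
  "mps_sum f A = Abs_mps (\<lambda>m. \<Sum>i | i \<in> A \<and> mps_coeff (f i) m \<noteq> 0. mps_coeff (f i) m)"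

text \<open>Exponential and logarithm, for arguments with constant term \<open>0\<close> and \<open>1\<close> respectively; for
  these the families are locally finite.\<close>

definition mps_exp :: "('v, 'a::comm_rat_algebra) mps \<Rightarrow> ('v, 'a) mps" where
  "mps_exp f = mps_sum (\<lambda>n. recip (fact n) * f ^ n) UNIV"

definition mps_log :: "('v, 'a::comm_rat_algebra) mps \<Rightarrow> ('v, 'a) mps" where
  "mps_log f = mps_sum (\<lambda>n. (- 1) ^ (n + 1) * recip n * (f - 1) ^ n) {1..}"

text \<open>Substitution of \<open>g v\<close> for the variable \<open>v\<close>.  The target has Laurent series coefficients, and
  the sum over all monomials of \<open>f\<close> is taken separately for each monomial and each power of the
  Laurent variable: for the substitutions below only these coefficients are finite sums.\<close>

definition mps_subst ::
  "('v \<Rightarrow> ('u, 'a::comm_ring_1 fls) mps) \<Rightarrow> ('v, 'a) mps \<Rightarrow> ('u, 'a fls) mps" where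
  "mps_subst g f =
    (let term = \<lambda>\<alpha>. mps_const (fls_const (mps_coeff f \<alpha>)) *
           (\<Prod>v\<in>Poly_Mapping.keys \<alpha>. g v ^ Poly_Mapping.lookup \<alpha> v);
         c = \<lambda>m n \<alpha>. fls_nth (mps_coeff (term \<alpha>) m) n
     in Abs_mps (\<lambda>m. Abs_fls (\<lambda>n. \<Sum>\<alpha> | c m n \<alpha> \<noteq> 0. c m n \<alpha>)))"


section \<open>The KP hierarchy\<close>

text \<open>Variables are numbered from \<open>0\<close>, so that there is no superfluous \<open>p\<^sub>0\<close>: for \<open>j \<ge> 1\<close>, the
  indeterminate \<open>p\<^sub>j\<close> is the variable with number \<open>j - 1\<close>, and \<open>pvar 0\<close> is not meaningful.\<close>

definition pvar :: "nat \<Rightarrow> (nat, 'a::comm_ring_1) mps" where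
  "pvar j = mps_var (j - 1)"

text \<open>The bilinear identity lives in \<open>K((z\<^sup>-\<^sup>1))[[p\<^sub>1, p\<^sub>2, \<dots>, p'\<^sub>1, p'\<^sub>2, \<dots>]]\<close>.  The Laurent variable
  \<open>fls_X\<close> is \<open>z\<^sup>-\<^sup>1\<close> (and \<open>fls_X_inv\<close> is \<open>z\<close>), because the shifted \<open>\<tau>\<close>s have coefficients with
  infinitely many negative, but no positive powers of \<open>z\<close>.\<close>

type_synonym 'k kp_ring = "(nat + nat, 'k fls) mps"

definition kp_p :: "nat \<Rightarrow> 'k::comm_ring_1 kp_ring" where
  "kp_p j = mps_var (Inl (j - 1))"

definition kp_p' :: "nat \<Rightarrow> 'k::comm_ring_1 kp_ring" where
  "kp_p' j = mps_var (Inr (j - 1))"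

abbreviation kp_z :: "'k::comm_ring_1 kp_ring" where
  "kp_z \<equiv> mps_const fls_X_inv"

abbreviation kp_zinv :: "'k::comm_ring_1 kp_ring" where
  "kp_zinv \<equiv> mps_const fls_X"

definition kp_bilinear :: "(nat, 'k::comm_rat_algebra) mps \<Rightarrow> 'k kp_ring" where
  "kp_bilinear \<tau> =
     mps_exp (mps_sum (\<lambda>i. recip i * (kp_p i - kp_p' i) * kp_z ^ i) {1..})
     * mps_subst (\<lambda>v. kp_p (v + 1) - kp_zinv ^ (v + 1)) \<tau>
     * mps_subst (\<lambda>v. kp_p' (v + 1) + kp_zinv ^ (v + 1)) \<tau>"

definition coeff_zinv :: "'k::comm_ring_1 kp_ring \<Rightarrow> (nat + nat, 'k) mps" where
  "coeff_zinv f = Abs_mps (\<lambda>m. fls_nth (mps_coeff f m) 1)"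

definition kp_solution :: "(nat, 'k::comm_rat_algebra) mps \<Rightarrow> bool" where
  "kp_solution F \<longleftrightarrow> mps_coeff F 0 = 0 \<and> coeff_zinv (kp_bilinear (mps_exp F)) = 0"


section \<open>Partitions and Schur functions\<close>

definition is_partition :: "nat list \<Rightarrow> bool" where
  "is_partition \<mu> \<longleftrightarrow> sorted_wrt (\<ge>) \<mu> \<and> (\<forall>k\<in>set \<mu>. k \<ge> 1)"

definition ferrers :: "nat list \<Rightarrow> (nat \<times> nat) set" where
  "ferrers \<mu> = {(i, j). 1 \<le> i \<and> i \<le> length \<mu> \<and> 1 \<le> j \<and> j \<le> \<mu> ! (i - 1)}"

definition cell_content :: "nat \<times> nat \<Rightarrow> int" where
  "cell_content = (\<lambda>(i, j). int j - int i)"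

text \<open>The generating series \<open>exp (\<Sum>k\<ge>1. p\<^sub>k t\<^sup>k / k)\<close> in \<open>t\<close>; \<open>p 0\<close> is ignored.\<close>

definition complete_series :: "(nat \<Rightarrow> 'a::comm_rat_algebra) \<Rightarrow> 'a fps" where
  "complete_series p =
     fps_compose (Abs_fps (\<lambda>n. recip (fact n))) (Abs_fps (\<lambda>k. if k = 0 then 0 else recip k * p k))"

definition complete_sym :: "(nat \<Rightarrow> 'a::comm_rat_algebra) \<Rightarrow> int \<Rightarrow> 'a" where
  "complete_sym p i = (if i < 0 then 0 else fps_nth (complete_series p) (nat i))"

text \<open>Row and column indices start at \<open>0\<close> here, which does not affect \<open>j - i\<close>.\<close>

definition schur :: "nat list \<Rightarrow> (nat \<Rightarrow> 'a::comm_rat_algebra) \<Rightarrow> 'a" where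
  "schur \<mu> p =
     det (mat (length \<mu>) (length \<mu>) (\<lambda>(i, j). complete_sym p (int (\<mu> ! i) - int i + int j)))"


section \<open>The ring of coefficients\<close>

text \<open>The polynomial ring over \<open>\<rat>\<close> in the indeterminates \<open>y\<^sub>i\<close> (\<open>i \<in> \<int>\<close>) and \<open>q\<^sub>j\<close> (\<open>j \<ge> 1\<close>), where
  \<open>q\<^sub>j\<close> is \<open>Q (j - 1)\<close>.  It suffices as the ring \<open>K\<close>: the coefficient of each monomial in the \<open>p\<^sub>j\<close>
  only involves partitions of one size.\<close>

datatype indet = Y int | Q nat

type_synonym yq_poly = "(indet \<Rightarrow>\<^sub>0 nat) \<Rightarrow>\<^sub>0 rat"

definition indet_poly :: "indet \<Rightarrow> yq_poly" where
  "indet_poly v = Poly_Mapping.single (Poly_Mapping.single v 1) 1"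

definition yvar :: "int \<Rightarrow> yq_poly" where
  "yvar i = indet_poly (Y i)"

definition qvar :: "nat \<Rightarrow> yq_poly" where
  "qvar j = indet_poly (Q (j - 1))"

end

theory Submission
  imports Defs
begin

text \<open>The theorem holds because the coefficient of each \<open>s\<^sub>\<lambda>(p)\<close> is a maximal minor of one
  infinite matrix, i.e. because the coefficients are the Pluecker coordinates of a point of an
  infinite Grassmannian. Put \<open>A m j = h\<^sub>m\<^sub>+\<^sub>j(q) * (\<Prod>c\<in>{-j..<m}. y\<^sub>c)\<close> for \<open>m \<in> \<int>\<close> and \<open>j \<ge> 0\<close>. In
  each term of the determinant of \<open>A (\<lambda>\<^sub>i - i) j\<close> the same content product can be pulled out,
  whichever permutation the term belongs to (\<open>prod_intervals_permute\<close>), so this determinant is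
  \<open>(\<Prod>w\<in>\<lambda>. y\<^bsub>c(w)\<^esub>) * s\<^sub>\<lambda>(q)\<close> (\<open>content_product_schur\<close>). The matrix is triangular in the sense that
  \<open>A m j = 0\<close> for \<open>m < -j\<close> and \<open>A (-j) j = 1\<close>, and every such \<open>A\<close> over every coefficient ring gives
  a solution (\<open>kp_solution_log_pluecker_series\<close>).

  By the Cauchy--Binet formula, the part of \<open>\<tau>\<close> with partitions inside a box is the determinant of
  the \<open>N \<times> N\<close> matrix \<open>g\<^sub>j(k) = (\<Sum>l. A l j * h\<^sub>l\<^sub>+\<^sub>k(p))\<close> (\<open>mps_of_mpoly_det_row_series\<close>). A given
  coefficient of the bilinear expression only sees the coefficients of \<open>\<tau>\<close> up to some weight
  (\<open>kp_bilinear_cong\<close>), so it is enough to prove the bilinear identity for these determinants,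
  which are polynomials.

  For them the identity is linear algebra (\<open>coeff_zinv_kp_determinant\<close>). Write \<open>w = z\<^sup>-\<^sup>1\<close>, and
  let \<open>u\<^sub>j(k)\<close> and \<open>v\<^sub>j(k)\<close> be \<open>g\<^sub>j(k)\<close> in the variables \<open>p\<close> and \<open>p'\<close>. Replacing \<open>p\<^sub>i\<close> by
  \<open>p\<^sub>i - w\<^sup>i\<close> multiplies the generating series of the \<open>h\<^sub>n\<close> by \<open>1 - w t\<close>, hence turns \<open>u\<^sub>j(k)\<close> into
  \<open>u\<^sub>j(k) - w * u\<^sub>j(k-1)\<close>; the determinant becomes \<open>\<Sum>s\<le>N. w\<^sup>s * D\<^sub>s\<close>, where the \<open>D\<^sub>s\<close> are up to sign
  the minors of the \<open>N \<times> (N+1)\<close> matrix with columns \<open>u(-1), \<dots>, u(N-1)\<close> obtained by omitting one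
  column. Replacing \<open>p'\<^sub>i\<close> by \<open>p'\<^sub>i + w\<^sup>i\<close> divides by \<open>1 - w t\<close>, and column operations undo this
  in all columns but the first; the determinant becomes \<open>\<Sum>r. w\<^sup>r * (\<Sum>j. v\<^sub>j(-r) * e\<^sub>j)\<close>, where \<open>e\<^sub>j\<close>
  are the cofactors of the first column. The exponential is \<open>\<Sum>n. h\<^sub>n(p - p') * z\<^sup>n\<close>, so that the
  coefficient of \<open>z\<^sup>-\<^sup>1\<close> is
  \<open>\<Sum>s r j. h\<^bsub>s+r-1\<^esub>(p - p') * D\<^sub>s * v\<^sub>j(-r) * e\<^sub>j\<close>. Because of
  \<open>u\<^sub>j(k) = (\<Sum>i. h\<^sub>i(p - p') * v\<^sub>j(k - i))\<close> and because the \<open>e\<^sub>j\<close> annihilate the columns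
  \<open>v(1), \<dots>, v(N-1)\<close>, summation over \<open>r\<close> gives \<open>\<Sum>s j. D\<^sub>s * u\<^sub>j(s-1) * e\<^sub>j\<close>. For each \<open>j\<close> the sum
  over \<open>s\<close> is the expansion of a determinant with two equal rows, hence zero
  (\<open>determinantal_bilinear_identity\<close>).\<close>

(* In this development $ only denotes coefficients of power series. *)
no_notation vec_index (infixl "$" 100)

section \<open>Complete symmetric functions as functions of power sums\<close>

lemma recip_unique:
  fixes x :: "'a::comm_rat_algebra"
  assumes "n > 0" "of_nat n * x = 1"
  shows "x = recip n"
proof -
  have "x = x * (of_nat n * recip n)"
    by (simp add: of_nat_mult_recip[OF assms(1)])
  also have "\<dots> = (of_nat n * x) * recip n"
    by (simp only: mult_ac)
  finally show ?thesis
    by (simp add: assms(2))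
qed

lemma of_nat_mult_left_cancel:
  fixes x y :: "'a::comm_rat_algebra"
  assumes "n > 0" "of_nat n * x = of_nat n * y"
  shows "x = y"
proof -
  have "(of_nat n * recip n) * x = (of_nat n * recip n) * y"
    using assms(2) by (metis mult.assoc mult.commute)
  then show ?thesis
    by (simp add: of_nat_mult_recip[OF assms(1)])
qed

lemma recip_1 [simp]: "recip (Suc 0) = (1 :: 'a::comm_rat_algebra)"
  by (rule recip_unique[symmetric]) auto

lemma of_nat_mult_recip_fact_Suc:
  "of_nat (Suc n) * recip (fact (Suc n)) = (recip (fact n) :: 'a::comm_rat_algebra)"
proof (rule recip_unique)
  have "of_nat (fact n) * (of_nat (Suc n) * recip (fact (Suc n))) =
      of_nat (fact (Suc n)) * (recip (fact (Suc n)) :: 'a)"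
    by (simp add: algebra_simps)
  then show "of_nat (fact n) * (of_nat (Suc n) * recip (fact (Suc n))) = (1 :: 'a)"
    by (simp add: of_nat_mult_recip del: fact_Suc)
qed simp

definition exp_series :: "'a::comm_rat_algebra fps" where
  "exp_series = Abs_fps (\<lambda>n. recip (fact n))"

text \<open>Termwise differentiation of the exponential series. The coefficient ring is an arbitrary
  commutative \<open>\<rat>\<close>-algebra, since later it will itself be a ring of series or of polynomials.\<close>

lemma fps_deriv_exp_series_compose:
  fixes b :: "'a::comm_rat_algebra fps"
  assumes b: "b $ 0 = 0"
  shows "fps_deriv (exp_series oo b) = fps_deriv b * (exp_series oo b)"
proof (rule fps_ext)
  fix n
  have zero: "b ^ i $ k = 0" if "k < i" for i k
    using startsby_zero_power_prefix[OF b] that by blast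
  have "fps_deriv (exp_series oo b) $ n =
      (\<Sum>i=0..Suc n. recip (fact i) * fps_deriv (b ^ i) $ n)"
    by (simp add: fps_compose_nth exp_series_def sum_distrib_left mult_ac del: sum.cl_ivl_Suc)
  also have "\<dots> = (\<Sum>i=0..n. recip (fact (Suc i)) * fps_deriv (b ^ Suc i) $ n)"
    by (subst sum.atLeast0_atMost_Suc_shift) (simp del: power_Suc fact_Suc)
  also have "\<dots> = (\<Sum>i=0..n. recip (fact i) * (fps_deriv b * b ^ i) $ n)"
  proof (rule sum.cong[OF refl])
    fix i
    have "fps_deriv (b ^ Suc i) $ n = of_nat (Suc i) * (fps_deriv b * b ^ i) $ n"
      by (subst fps_deriv_power) (simp add: mult.assoc del: power_Suc of_nat_Suc)
    then show "recip (fact (Suc i)) * fps_deriv (b ^ Suc i) $ n =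
        recip (fact i) * (fps_deriv b * b ^ i) $ n"
      using of_nat_mult_recip_fact_Suc[of i, where 'a = 'a]
      by (metis mult.assoc mult.commute)
  qed
  also have "\<dots> = (\<Sum>i=0..n. \<Sum>j=0..n. fps_deriv b $ j * (recip (fact i) * b ^ i $ (n - j)))"
    by (simp add: fps_mult_nth sum_distrib_left mult_ac)
  also have "\<dots> = (\<Sum>j=0..n. \<Sum>i=0..n. fps_deriv b $ j * (recip (fact i) * b ^ i $ (n - j)))"
    by (rule sum.swap)
  also have "\<dots> = (\<Sum>j=0..n. \<Sum>i=0..n - j. fps_deriv b $ j * (recip (fact i) * b ^ i $ (n - j)))"
    by (intro sum.cong[OF refl] sum.mono_neutral_right) (auto simp: zero)
  also have "\<dots> = (fps_deriv b * (exp_series oo b)) $ n"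
    by (simp add: fps_mult_nth fps_compose_nth sum_distrib_left exp_series_def)
  finally show "fps_deriv (exp_series oo b) $ n = (fps_deriv b * (exp_series oo b)) $ n" .
qed

lemma fps_deriv_complete_series:
  "fps_deriv (complete_series p) = Abs_fps (\<lambda>j. p (Suc j)) * complete_series p"
proof -
  have "fps_deriv (Abs_fps (\<lambda>k. if k = 0 then 0 else recip k * p k)) = Abs_fps (\<lambda>j. p (Suc j))"
  proof (rule fps_ext)
    fix n
    have "of_nat (Suc n) * (recip (Suc n) * p (Suc n)) = p (Suc n)"
      by (simp only: mult.assoc[symmetric] of_nat_mult_recip[OF zero_less_Suc] mult_1)
    then show "fps_deriv (Abs_fps (\<lambda>k. if k = 0 then 0 else recip k * p k)) $ n =
        Abs_fps (\<lambda>j. p (Suc j)) $ n"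
      by (simp del: of_nat_Suc)
  qed
  then show ?thesis
    using fps_deriv_exp_series_compose[of "Abs_fps (\<lambda>k. if k = 0 then 0 else recip k * p k)"]
    by (simp add: complete_series_def exp_series_def)
qed

lemma complete_series_nth_0 [simp]: "complete_series p $ 0 = 1"
  by (simp add: complete_series_def)

text \<open>The complete symmetric functions are the unique solution of Newton's identities
  \<open>n h\<^sub>n = (\<Sum>k=1..n. p\<^sub>k h\<^bsub>n-k\<^esub>)\<close>. In terms of the generating series
  this is a linear differential equation; all further properties are obtained by checking it, without
  returning to the exponential.\<close>

lemma complete_series_unique:
  fixes p :: "nat \<Rightarrow> 'a::comm_rat_algebra"
  assumes "A $ 0 = 1" "fps_deriv A = Abs_fps (\<lambda>j. p (Suc j)) * A"
  shows "A = complete_series p"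
proof (rule fps_ext)
  fix n
  have step: "of_nat (Suc n) * B $ (Suc n) = (\<Sum>j=0..n. p (Suc j) * B $ (n - j))"
    if "fps_deriv B = Abs_fps (\<lambda>j. p (Suc j)) * B" for B n
    using arg_cong[OF that, of "\<lambda>f. f $ n"] by (simp add: fps_mult_nth)
  show "A $ n = complete_series p $ n"
  proof (induction n rule: less_induct)
    case (less n)
    show ?case
    proof (cases n)
      case 0
      then show ?thesis by (simp add: assms(1))
    next
      case (Suc m)
      have "of_nat (Suc m) * A $ (Suc m) = of_nat (Suc m) * complete_series p $ (Suc m)"
        unfolding step[OF assms(2)] step[OF fps_deriv_complete_series]
        by (rule sum.cong) (use less Suc in auto)
      then show ?thesis
        unfolding Suc by (rule of_nat_mult_left_cancel[rotated]) simp
    qed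
  qed
qed

lemma complete_series_add:
  "complete_series (\<lambda>k. p k + q k) = complete_series p * complete_series q"
proof (rule complete_series_unique[symmetric])
  have "Abs_fps (\<lambda>j. p (Suc j) + q (Suc j)) = Abs_fps (\<lambda>j. p (Suc j)) + Abs_fps (\<lambda>j. q (Suc j))"
    by (rule fps_ext) simp
  then show "fps_deriv (complete_series p * complete_series q) =
      Abs_fps (\<lambda>j. p (Suc j) + q (Suc j)) * (complete_series p * complete_series q)"
    by (simp add: fps_deriv_complete_series algebra_simps)
qed simp

lemma complete_series_power: "complete_series (\<lambda>k. w ^ k) = Abs_fps (\<lambda>n. w ^ n)"
proof (rule complete_series_unique[symmetric])
  show "fps_deriv (Abs_fps (\<lambda>n. w ^ n)) = Abs_fps (\<lambda>j. w ^ Suc j) * Abs_fps (\<lambda>n. w ^ n)"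
  proof (rule fps_ext)
    fix n
    have "(\<Sum>i=0..n. w ^ Suc i * w ^ (n - i)) = (\<Sum>i=0..n. w ^ Suc n)"
      by (rule sum.cong) (auto simp: power_add[symmetric] simp del: power_Suc)
    then show "fps_deriv (Abs_fps (\<lambda>n. w ^ n)) $ n =
        (Abs_fps (\<lambda>j. w ^ Suc j) * Abs_fps (\<lambda>n. w ^ n)) $ n"
      by (simp add: fps_mult_nth del: power_Suc)
  qed
qed simp

text \<open>In analytic terms \<open>exp (- (\<Sum>k\<ge>1. (w t)\<^sup>k / k)) = 1 - w t\<close>. This gives the rule for the
  substitution \<open>p\<^sub>k - w\<^sup>k\<close> below, and at \<open>w = -1\<close> it says that \<open>exp\<close> inverts \<open>log (1 + t)\<close>.\<close>

lemma complete_series_minus_power: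
  "complete_series (\<lambda>k. - (w ^ k)) = 1 - fps_const w * fps_X"
proof (rule complete_series_unique[symmetric])
  show "fps_deriv (1 - fps_const w * fps_X) = Abs_fps (\<lambda>j. - (w ^ Suc j)) * (1 - fps_const w * fps_X)"
  proof (rule fps_ext)
    fix n
    show "fps_deriv (1 - fps_const w * fps_X) $ n =
        (Abs_fps (\<lambda>j. - (w ^ Suc j)) * (1 - fps_const w * fps_X)) $ n"
      by (cases n) (auto simp: right_diff_distrib mult.assoc[symmetric])
  qed
qed simp

lemma complete_sym_neg [simp]: "n < 0 \<Longrightarrow> complete_sym p n = 0"
  by (simp add: complete_sym_def)

lemma complete_sym_0 [simp]: "complete_sym p 0 = 1"
  by (simp add: complete_sym_def)

lemma complete_sym_of_mult:
  assumes F: "complete_series p = complete_series q * complete_series r" and "n \<le> int R"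
  shows "complete_sym p n = (\<Sum>i\<le>R. complete_sym q (int i) * complete_sym r (n - int i))"
proof (cases "n < 0")
  case False
  then obtain k where k: "n = int k"
    by (metis nonneg_int_cases not_le)
  have "complete_sym p n = (\<Sum>i\<le>k. complete_sym q (int i) * complete_sym r (n - int i))"
    unfolding complete_sym_def k F fps_mult_nth atLeast0AtMost
    by (auto intro!: sum.cong simp: nat_diff_distrib)
  also have "\<dots> = (\<Sum>i\<le>R. complete_sym q (int i) * complete_sym r (n - int i))"
    by (rule sum.mono_neutral_left) (use assms(2) in \<open>auto simp: k\<close>)
  finally show ?thesis .
qed simp

lemma complete_sym_add:
  "n \<le> int R \<Longrightarrow> complete_sym (\<lambda>k. p k + q k) n =
     (\<Sum>i\<le>R. complete_sym p (int i) * complete_sym q (n - int i))"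
  by (rule complete_sym_of_mult[OF complete_series_add])

text \<open>Here \<open>R\<close> can be any upper bound, since \<open>complete_sym\<close> vanishes at negative indices; a common
  bound for several \<open>n\<close> keeps the sums aligned.\<close>

lemma complete_sym_add_power:
  assumes "n \<le> int R"
  shows "complete_sym (\<lambda>k. p k + w ^ k) n = (\<Sum>r\<le>R. w ^ r * complete_sym p (n - int r))"
proof -
  have "complete_sym (\<lambda>k. w ^ k + p k) n = (\<Sum>r\<le>R. w ^ r * complete_sym p (n - int r))"
    by (subst complete_sym_add[OF assms]) (simp add: complete_sym_def complete_series_power)
  then show ?thesis
    by (simp add: add.commute)
qed

lemma complete_sym_diff_power:
  "complete_sym (\<lambda>k. p k - w ^ k) n = complete_sym p n - w * complete_sym p (n - 1)"
proof (cases "n < 0")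
  case False
  then obtain k where k: "n = int k"
    by (metis nonneg_int_cases not_le)
  have "complete_series (\<lambda>k. p k - w ^ k) = complete_series p * (1 - fps_const w * fps_X)"
    using complete_series_add[of p "\<lambda>k. - (w ^ k)"] by (simp add: complete_series_minus_power)
  moreover have "nat (int (Suc m) - 1) = m" for m
    by simp
  ultimately show ?thesis
    by (cases k) (auto simp: complete_sym_def k right_diff_distrib
        mult.assoc[symmetric] mult.commute[of w] simp del: of_nat_Suc)
qed simp

lemma complete_sym_hom:
  fixes hom :: "'a::comm_rat_algebra \<Rightarrow> 'b::comm_rat_algebra"
  assumes "comm_ring_hom hom"
  shows "hom (complete_sym p n) = complete_sym (\<lambda>k. hom (p k)) n"
proof -
  interpret comm_ring_hom hom by fact
  have "Abs_fps (\<lambda>n. hom (complete_series p $ n)) = complete_series (\<lambda>k. hom (p k))"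
  proof (rule complete_series_unique)
    show "fps_deriv (Abs_fps (\<lambda>n. hom (complete_series p $ n))) =
        Abs_fps (\<lambda>j. hom (p (Suc j))) * Abs_fps (\<lambda>n. hom (complete_series p $ n))"
    proof (rule fps_ext)
      fix n
      have "hom (fps_deriv (complete_series p) $ n) =
          hom ((Abs_fps (\<lambda>j. p (Suc j)) * complete_series p) $ n)"
        by (simp only: fps_deriv_complete_series)
      then show "fps_deriv (Abs_fps (\<lambda>n. hom (complete_series p $ n))) $ n =
          (Abs_fps (\<lambda>j. hom (p (Suc j))) * Abs_fps (\<lambda>n. hom (complete_series p $ n))) $ n"
        by (simp add: fps_mult_nth hom_mult hom_sum hom_add hom_of_nat)
    qed
  qed simp
  from arg_cong[OF this, of "\<lambda>f. f $ nat n"] show ?thesis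
    by (simp add: complete_sym_def)
qed

lemma complete_sym_cong:
  assumes "\<And>k. k \<ge> 1 \<Longrightarrow> p k = q k"
  shows "complete_sym p n = complete_sym q n"
proof -
  have "(\<lambda>k. if k = 0 then 0 else recip k * p k) = (\<lambda>k. if k = 0 then 0 else recip k * q k)"
    using assms by (intro ext) simp
  then show ?thesis
    by (simp add: complete_sym_def complete_series_def)
qed

section \<open>Power series in many variables: evaluation, exponential and logarithm\<close>

text \<open>With \<open>\<rho> v = 1\<close> this is the degree of a monomial; the KP hierarchy is graded by giving \<open>p\<^sub>j\<close>
  the weight \<open>j\<close>.\<close>

definition weight :: "('v \<Rightarrow> nat) \<Rightarrow> ('v \<Rightarrow>\<^sub>0 nat) \<Rightarrow> nat" where
  "weight \<rho> m = (\<Sum>v\<in>Poly_Mapping.keys m. \<rho> v * Poly_Mapping.lookup m v)"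

lemma weight_superset:
  assumes "finite S" "Poly_Mapping.keys m \<subseteq> S"
  shows "weight \<rho> m = (\<Sum>v\<in>S. \<rho> v * Poly_Mapping.lookup m v)"
  unfolding weight_def by (rule sum.mono_neutral_left) (use assms in \<open>auto simp: in_keys_iff\<close>)

lemma weight_add: "weight \<rho> (a + b) = weight \<rho> a + weight \<rho> b"
proof -
  let ?S = "Poly_Mapping.keys a \<union> Poly_Mapping.keys b"
  have "Poly_Mapping.keys (a + b) \<subseteq> ?S"
    by (rule keys_add)
  then show ?thesis
    by (simp add: weight_superset[of ?S] lookup_add sum.distrib algebra_simps)
qed

lemma weight_0 [simp]: "weight \<rho> 0 = 0"
  by (simp add: weight_def)

lemma weight_single [simp]: "weight \<rho> (Poly_Mapping.single v k) = \<rho> v * k"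
  by (simp add: weight_superset[of "{v}"])

lemma weight_eq_0_iff:
  assumes "\<And>v. \<rho> v > 0"
  shows "weight \<rho> m = 0 \<longleftrightarrow> m = 0"
proof
  assume "weight \<rho> m = 0"
  then have "\<rho> v * Poly_Mapping.lookup m v = 0" if "v \<in> Poly_Mapping.keys m" for v
    using that by (auto simp: weight_def)
  with assms have "Poly_Mapping.keys m = {}"
    by (metis ex_in_conv in_keys_iff mult_eq_0_iff less_irrefl)
  then show "m = 0"
    by simp
qed simp

lemma weight_splits: "(a, b) \<in> splits m \<Longrightarrow> weight \<rho> m = weight \<rho> a + weight \<rho> b"
  by (auto simp: splits_def weight_add)

lemma mps_coeff_0 [simp]: "mps_coeff 0 m = 0"
  by (simp add: zero_mps_def)

lemma mps_coeff_1: "mps_coeff 1 m = (if m = 0 then 1 else 0)"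
  by (simp add: one_mps_def)

lemma mps_coeff_add [simp]: "mps_coeff (f + g) m = mps_coeff f m + mps_coeff g m"
  by (simp add: plus_mps_def)

lemma mps_coeff_diff [simp]: "mps_coeff (f - g) m = mps_coeff f m - mps_coeff g m"
  by (simp add: minus_mps_def)

lemma mps_coeff_uminus [simp]: "mps_coeff (- f) m = - mps_coeff f m"
  by (simp add: uminus_mps_def)

lemma mps_coeff_mult: "mps_coeff (f * g) m = (\<Sum>(a, b)\<in>splits m. mps_coeff f a * mps_coeff g b)"
  by (simp add: times_mps_def)

lemma mps_coeff_sum: "mps_coeff (sum f A) m = (\<Sum>i\<in>A. mps_coeff (f i) m)"
  by (induction A rule: infinite_finite_induct) auto

lemma mps_coeff_const: "mps_coeff (mps_const c) m = (if m = 0 then c else 0)"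
  by (simp add: mps_const_def)

lemma mps_coeff_var: "mps_coeff (mps_var v) m = (if m = Poly_Mapping.single v 1 then 1 else 0)"
  by (simp add: mps_var_def)

lemma mps_coeff_const_mult [simp]: "mps_coeff (mps_const c * f) m = c * mps_coeff f m"
proof -
  have "mps_coeff (mps_const c * f) m = (\<Sum>w\<in>splits m. if w = (0, m) then c * mps_coeff f m else 0)"
    unfolding mps_coeff_mult by (rule sum.cong) (auto simp: mps_coeff_const splits_def split: if_splits)
  also have "\<dots> = c * mps_coeff f m"
    by (subst sum.delta[OF finite_splits]) (auto simp: splits_def)
  finally show ?thesis .
qed

lemma comm_ring_hom_mps_const: "comm_ring_hom (mps_const :: 'a::comm_ring_1 \<Rightarrow> ('v, 'a) mps)"
  by unfold_locales (auto intro!: mps_eqI simp: mps_coeff_const mps_const_mult_const)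

lemma recip_hom:
  fixes h :: "'a::comm_rat_algebra \<Rightarrow> 'b::comm_rat_algebra"
  assumes "comm_ring_hom h" "n > 0"
  shows "h (recip n) = recip n"
proof -
  interpret comm_ring_hom h by fact
  show ?thesis
  proof (rule recip_unique[OF assms(2)])
    have "of_nat n * h (recip n) = h (of_nat n * recip n)"
      by (simp add: hom_mult hom_of_nat)
    then show "of_nat n * h (recip n) = 1"
      by (simp add: of_nat_mult_recip[OF assms(2)])
  qed
qed

lemma recip_mps: "n > 0 \<Longrightarrow> recip n = mps_const (recip n)"
  by (rule recip_hom[OF comm_ring_hom_mps_const, symmetric])

lemma mps_coeff_mps_sum:
  assumes "finite B" "B \<subseteq> A" "\<And>i. i \<in> A \<Longrightarrow> i \<notin> B \<Longrightarrow> mps_coeff (f i) m = 0"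
  shows "mps_coeff (mps_sum f A) m = (\<Sum>i\<in>B. mps_coeff (f i) m)"
  unfolding mps_sum_def mps_coeff_Abs
  by (rule sum.mono_neutral_left) (use assms in \<open>auto intro: finite_subset\<close>)

lemma mps_coeff_mult_eq_0:
  assumes "\<And>a b. (a, b) \<in> splits m \<Longrightarrow> mps_coeff f a = 0 \<or> mps_coeff g b = 0"
  shows "mps_coeff (f * g) m = 0"
  unfolding mps_coeff_mult by (rule sum.neutral) (use assms in fastforce)

text \<open>This makes exponential and logarithm locally finite families.\<close>

lemma mps_coeff_power_eq_0:
  fixes f :: "('v, 'a::comm_ring_1) mps"
  assumes "mps_coeff f 0 = 0" "\<And>v. \<rho> v > 0" "weight \<rho> m < n"
  shows "mps_coeff (f ^ n) m = 0"
  using assms(3)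
proof (induction n arbitrary: m)
  case (Suc n)
  show ?case
    unfolding power_Suc
  proof (rule mps_coeff_mult_eq_0)
    fix a b
    assume ab: "(a, b) \<in> splits m"
    show "mps_coeff f a = 0 \<or> mps_coeff (f ^ n) b = 0"
    proof (cases "a = 0")
      case False
      then have "weight \<rho> a > 0"
        using weight_eq_0_iff[of \<rho>] assms(2) by auto
      then have "mps_coeff (f ^ n) b = 0"
        using Suc.prems by (intro Suc.IH) (simp add: weight_splits[OF ab])
      then show ?thesis ..
    qed (simp add: assms(1))
  qed
qed simp

abbreviation mdeg :: "('v \<Rightarrow>\<^sub>0 nat) \<Rightarrow> nat" where
  "mdeg \<equiv> weight (\<lambda>_. 1)"

text \<open>The result of inserting \<open>x\<close>, a series without constant term, for the variable of a power series
  in one variable. The coefficients may themselves be series, so that constants in the sense of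
  \<open>fps_const\<close> are arbitrary elements of the ring.\<close>

definition mps_eval :: "('v, 'a::comm_ring_1) mps \<Rightarrow> ('v, 'a) mps fps \<Rightarrow> ('v, 'a) mps" where
  "mps_eval x b = mps_sum (\<lambda>n. b $ n * x ^ n) UNIV"

context
  fixes x :: "('v, 'a::comm_ring_1) mps"
  assumes x0: "mps_coeff x 0 = 0"
begin

lemma mps_coeff_mult_power_eq_0:
  assumes "mdeg m < n"
  shows "mps_coeff (c * x ^ n) m = 0"
proof (rule mps_coeff_mult_eq_0)
  fix a b
  assume "(a, b) \<in> splits m"
  then have "mdeg b < n"
    using assms weight_splits[of a b m "\<lambda>_. 1"] by simp
  then show "mps_coeff c a = 0 \<or> mps_coeff (x ^ n) b = 0"
    by (intro disjI2 mps_coeff_power_eq_0[OF x0]) auto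
qed

lemma mps_coeff_eval:
  "mdeg m \<le> D \<Longrightarrow> mps_coeff (mps_eval x b) m = mps_coeff (\<Sum>n\<le>D. b $ n * x ^ n) m"
  unfolding mps_eval_def mps_coeff_sum
  by (rule mps_coeff_mps_sum) (auto intro: mps_coeff_mult_power_eq_0)

text \<open>At a fixed monomial \<open>m\<close> only the powers \<open>x\<^sup>n\<close> with \<open>n\<close> at most the degree of \<open>m\<close> matter, so the
  claim reduces to the product of two truncated polynomials, whose terms of total exponent beyond
  that degree vanish.\<close>

lemma mps_eval_mult: "mps_eval x (b * c) = mps_eval x b * mps_eval x c"
proof (rule mps_eqI)
  fix m :: "'v \<Rightarrow>\<^sub>0 nat"
  define D where "D = mdeg m"
  let ?t = "\<lambda>(i, j). mps_coeff (b $ i * c $ j * x ^ (i + j)) m"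
  have "mps_coeff (mps_eval x b * mps_eval x c) m =
      mps_coeff ((\<Sum>n\<le>D. b $ n * x ^ n) * (\<Sum>n\<le>D. c $ n * x ^ n)) m"
    unfolding mps_coeff_mult
  proof (rule sum.cong[OF refl], clarify)
    fix a a'
    assume "(a, a') \<in> splits m"
    then have "mdeg a \<le> D" "mdeg a' \<le> D"
      using weight_splits[of a a' m "\<lambda>_. 1"] by (auto simp: D_def)
    then show "mps_coeff (mps_eval x b) a * mps_coeff (mps_eval x c) a' =
        mps_coeff (\<Sum>n\<le>D. b $ n * x ^ n) a * mps_coeff (\<Sum>n\<le>D. c $ n * x ^ n) a'"
      by (simp only: mps_coeff_eval)
  qed
  also have "\<dots> = (\<Sum>ij\<in>{..D} \<times> {..D}. ?t ij)"
    by (simp add: sum_product mps_coeff_sum sum.cartesian_product power_add mult_ac case_prod_beta)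
  also have "\<dots> = (\<Sum>ij\<in>{(i, j). i + j \<le> D}. ?t ij)"
    by (rule sum.mono_neutral_right) (auto intro!: mps_coeff_mult_power_eq_0 simp: D_def)
  also have "\<dots> = (\<Sum>(n, i)\<in>(SIGMA n:{..D}. {..n}). mps_coeff (b $ i * c $ (n - i) * x ^ n) m)"
    by (rule sum.reindex_bij_witness[where i = "\<lambda>(n, i). (i, n - i)" and j = "\<lambda>(i, j). (i + j, i)"])
       auto
  also have "\<dots> = mps_coeff (\<Sum>n\<le>D. (b * c) $ n * x ^ n) m"
    by (subst sum.Sigma[symmetric])
       (auto simp: mps_coeff_sum fps_mult_nth sum_distrib_right atLeast0AtMost)
  also have "\<dots> = mps_coeff (mps_eval x (b * c)) m"
    by (rule mps_coeff_eval[symmetric]) (simp add: D_def)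
  finally show "mps_coeff (mps_eval x (b * c)) m = mps_coeff (mps_eval x b * mps_eval x c) m" ..
qed

lemma mps_eval_const: "mps_eval x (fps_const c) = c"
  by (rule mps_eqI, subst mps_coeff_eval[OF order_refl])
     (simp add: if_distrib if_distribR cong: if_cong)

lemma mps_eval_add: "mps_eval x (b + c) = mps_eval x b + mps_eval x c"
  by (rule mps_eqI) (simp add: mps_coeff_eval[OF order_refl] algebra_simps sum.distrib)

lemma mps_eval_X: "mps_eval x fps_X = x"
proof (rule mps_eqI)
  fix m
  have "mps_coeff (mps_eval x fps_X) m = mps_coeff (\<Sum>n\<le>Suc (mdeg m). fps_X $ n * x ^ n) m"
    by (rule mps_coeff_eval) simp
  also have "(\<Sum>n\<le>Suc (mdeg m). fps_X $ n * x ^ n) = x"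
    by (simp add: if_distrib if_distribR cong: if_cong)
  finally show "mps_coeff (mps_eval x fps_X) m = mps_coeff x m" .
qed

lemma mps_eval_power: "mps_eval x (b ^ i) = mps_eval x b ^ i"
  by (induction i) (use mps_eval_const[of 1] in \<open>auto simp: mps_eval_mult\<close>)

lemma mps_coeff_0_eval:
  assumes "b $ 0 = 0"
  shows "mps_coeff (mps_eval x b) 0 = 0"
  by (subst mps_coeff_eval[OF order_refl]) (simp add: assms)

end

lemma mps_eval_compose:
  fixes x :: "('v, 'a::comm_ring_1) mps"
  assumes x0: "mps_coeff x 0 = 0" and b0: "b $ 0 = 0"
  shows "mps_eval (mps_eval x b) a = mps_eval x (a oo b)"
proof (rule mps_eqI)
  fix m :: "'v \<Rightarrow>\<^sub>0 nat"
  define D where "D = mdeg m"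
  have zero: "b ^ i $ k = 0" if "k < i" for i k
    using startsby_zero_power_prefix[OF b0] that by blast
  have "mps_coeff (mps_eval (mps_eval x b) a) m = (\<Sum>i\<le>D. mps_coeff (a $ i * mps_eval x b ^ i) m)"
    by (subst mps_coeff_eval[OF mps_coeff_0_eval[OF x0 b0], of _ D]) (simp_all add: D_def mps_coeff_sum)
  also have "\<dots> = (\<Sum>i\<le>D. mps_coeff (mps_eval x (fps_const (a $ i) * b ^ i)) m)"
    by (simp add: mps_eval_mult[OF x0] mps_eval_const[OF x0] mps_eval_power[OF x0])
  also have "\<dots> = (\<Sum>i\<le>D. mps_coeff (\<Sum>n\<le>D. (fps_const (a $ i) * b ^ i) $ n * x ^ n) m)"
    by (simp add: mps_coeff_eval[OF x0, of _ D] D_def)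
  also have "\<dots> = mps_coeff (\<Sum>n\<le>D. \<Sum>i\<le>D. a $ i * b ^ i $ n * x ^ n) m"
    by (simp only: mps_coeff_sum[symmetric] fps_mult_left_const_nth) (subst sum.swap, rule refl)
  also have "(\<Sum>n\<le>D. \<Sum>i\<le>D. a $ i * b ^ i $ n * x ^ n) = (\<Sum>n\<le>D. \<Sum>i\<le>n. a $ i * b ^ i $ n * x ^ n)"
    by (intro sum.cong[OF refl] sum.mono_neutral_right) (auto simp: zero)
  also have "mps_coeff \<dots> m = mps_coeff (mps_eval x (a oo b)) m"
    by (simp add: mps_coeff_eval[OF x0, of _ D] D_def fps_compose_nth sum_distrib_right atLeast0AtMost)
  finally show "mps_coeff (mps_eval (mps_eval x b) a) m = mps_coeff (mps_eval x (a oo b)) m" .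
qed

text \<open>The coefficients of the logarithm are written in the form \<open>p\<^sub>k / k\<close> with \<open>p\<^sub>k = - (-1)\<^sup>k\<close>, so that
  inserting the series into the exponential is an instance of \<open>complete_series\<close>.\<close>

lemma mps_log_eq:
  "mps_log f = mps_eval (f - 1) (Abs_fps (\<lambda>k. if k = 0 then 0 else recip k * - ((- 1) ^ k)))"
  if "mps_coeff f 0 = 1"
proof (rule mps_eqI)
  fix m
  have x0: "mps_coeff (f - 1) 0 = 0"
    using that by (simp add: mps_coeff_1)
  have "mps_coeff (mps_log f) m =
      (\<Sum>n\<in>{1..mdeg m}. mps_coeff ((- 1) ^ (n + 1) * recip n * (f - 1) ^ n) m)"
    unfolding mps_log_def
    by (rule mps_coeff_mps_sum) (auto intro!: mps_coeff_mult_power_eq_0[OF x0])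
  also have "\<dots> = (\<Sum>n\<in>{..mdeg m}. mps_coeff ((if n = 0 then 0 else recip n * - ((- 1) ^ n)) * (f - 1) ^ n) m)"
    by (rule sum.mono_neutral_cong_left) (auto simp: mult_ac)
  finally show "mps_coeff (mps_log f) m = mps_coeff (mps_eval (f - 1)
      (Abs_fps (\<lambda>k. if k = 0 then 0 else recip k * - ((- 1) ^ k)))) m"
    by (simp add: mps_coeff_eval[OF x0 order_refl] mps_coeff_sum)
qed

lemma mps_exp_eq: "mps_exp f = mps_eval f exp_series"
  by (simp add: mps_exp_def mps_eval_def exp_series_def)

lemma mps_coeff_0_log: "mps_coeff f 0 = 1 \<Longrightarrow> mps_coeff (mps_log f) 0 = 0"
  by (simp add: mps_log_eq mps_coeff_0_eval mps_coeff_1)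

text \<open>Composing the two defining series gives \<open>1 + t\<close>, by \<open>complete_series_minus_power\<close> at
  \<open>w = -1\<close>.\<close>

lemma mps_exp_log:
  fixes f :: "('v, 'a::comm_rat_algebra) mps"
  assumes "mps_coeff f 0 = 1"
  shows "mps_exp (mps_log f) = f"
proof -
  have x0: "mps_coeff (f - 1) 0 = 0"
    using assms by (simp add: mps_coeff_1)
  have "mps_exp (mps_log f) = mps_eval (f - 1) (complete_series (\<lambda>k. - ((- 1) ^ k)))"
    by (simp add: mps_exp_eq mps_log_eq[OF assms] mps_eval_compose[OF x0] complete_series_def
        exp_series_def)
  also have "complete_series (\<lambda>k. - ((- 1) ^ k)) = fps_const 1 + (fps_X :: ('v, 'a) mps fps)"
    by (simp add: complete_series_minus_power fps_const_neg[symmetric] del: fps_const_neg)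
  also have "mps_eval (f - 1) \<dots> = f"
    by (simp add: mps_eval_add[OF x0] mps_eval_const[OF x0] mps_eval_X[OF x0] del: fps_const_1_eq_1)
  finally show ?thesis .
qed

section \<open>Substitution into polynomials, and truncation by weight\<close>

text \<open>Substitution is a ring homomorphism on polynomials, where no question of convergence arises.
  Keeping the polynomials as a ring of their own makes them the domain of honest homomorphisms, which
  commute with determinants and with \<open>complete_sym\<close>.\<close>

type_synonym ('v, 'a) mpoly = "('v \<Rightarrow>\<^sub>0 nat) \<Rightarrow>\<^sub>0 'a"

text \<open>Polynomials are sums of monomials, so multiplicativity needs to be checked on monomials only.\<close>

lemma mpoly_additive_imp_hom:
  fixes h :: "('v, 'a::comm_ring_1) mpoly \<Rightarrow> 'b::comm_ring_1"
  assumes add: "\<And>P Q. h (P + Q) = h P + h Q"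
    and single: "\<And>\<alpha> \<beta> a b. h (Poly_Mapping.single (\<alpha> + \<beta>) (a * b)) =
      h (Poly_Mapping.single \<alpha> a) * h (Poly_Mapping.single \<beta> b)"
    and one: "h 1 = 1"
  shows "comm_ring_hom h"
proof
  have zero: "h 0 = 0"
    using add[of 0 0] by simp
  have sum: "h (sum f A) = (\<Sum>i\<in>A. h (f i))" for f :: "'i \<Rightarrow> ('v, 'a) mpoly" and A
    by (induction A rule: infinite_finite_induct) (auto simp: zero add)
  show "h (P * Q) = h P * h Q" for P Q
  proof -
    have expand: "R = (\<Sum>\<alpha>\<in>Poly_Mapping.keys R. Poly_Mapping.single \<alpha> (Poly_Mapping.lookup R \<alpha>))"
      for R :: "('v, 'a) mpoly"
      by (rule poly_mapping_eqI) (auto simp: lookup_sum lookup_single when_def in_keys_iff)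
    have "h (P * Q) = (\<Sum>\<alpha>\<in>Poly_Mapping.keys P. \<Sum>\<beta>\<in>Poly_Mapping.keys Q.
        h (Poly_Mapping.single (\<alpha> + \<beta>) (Poly_Mapping.lookup P \<alpha> * Poly_Mapping.lookup Q \<beta>)))"
      by (subst (2) expand, subst expand) (simp add: sum_product mult_single sum)
    also have "\<dots> = (\<Sum>\<alpha>\<in>Poly_Mapping.keys P. h (Poly_Mapping.single \<alpha> (Poly_Mapping.lookup P \<alpha>))) *
        (\<Sum>\<beta>\<in>Poly_Mapping.keys Q. h (Poly_Mapping.single \<beta> (Poly_Mapping.lookup Q \<beta>)))"
      by (simp add: sum_product single)
    also have "\<dots> = h P * h Q"
      by (simp only: sum[symmetric] expand[symmetric])
    finally show ?thesis .
  qed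
qed (use one add[of 0 0] add in auto)

definition mps_of_mpoly :: "('v, 'a::comm_ring_1) mpoly \<Rightarrow> ('v, 'a) mps" where
  "mps_of_mpoly P = Abs_mps (Poly_Mapping.lookup P)"

lemma mps_coeff_of_mpoly [simp]: "mps_coeff (mps_of_mpoly P) m = Poly_Mapping.lookup P m"
  by (simp add: mps_of_mpoly_def)

lemma comm_ring_hom_mps_of_mpoly:
  "comm_ring_hom (mps_of_mpoly :: ('v, 'a::comm_ring_1) mpoly \<Rightarrow> ('v, 'a) mps)"
proof (rule mpoly_additive_imp_hom)
  fix \<alpha> \<beta> :: "'v \<Rightarrow>\<^sub>0 nat" and a b :: 'a
  show "mps_of_mpoly (Poly_Mapping.single (\<alpha> + \<beta>) (a * b)) =
      mps_of_mpoly (Poly_Mapping.single \<alpha> a) * mps_of_mpoly (Poly_Mapping.single \<beta> b)"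
  proof (rule mps_eqI)
    fix m
    have "mps_coeff (mps_of_mpoly (Poly_Mapping.single \<alpha> a) * mps_of_mpoly (Poly_Mapping.single \<beta> b)) m =
        (\<Sum>w\<in>splits m. if w = (\<alpha>, \<beta>) then a * b else 0)"
      unfolding mps_coeff_mult by (rule sum.cong) (auto simp: lookup_single when_def split: if_splits)
    also have "\<dots> = mps_coeff (mps_of_mpoly (Poly_Mapping.single (\<alpha> + \<beta>) (a * b))) m"
      by (subst sum.delta[OF finite_splits]) (auto simp: splits_def lookup_single when_def)
    finally show "mps_coeff (mps_of_mpoly (Poly_Mapping.single (\<alpha> + \<beta>) (a * b))) m =
        mps_coeff (mps_of_mpoly (Poly_Mapping.single \<alpha> a) * mps_of_mpoly (Poly_Mapping.single \<beta> b)) m" ..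
  qed
qed (auto intro!: mps_eqI simp: lookup_add mps_coeff_1 lookup_one when_def)

definition mono_subst :: "('v \<Rightarrow> 'b::comm_ring_1) \<Rightarrow> ('v \<Rightarrow>\<^sub>0 nat) \<Rightarrow> 'b" where
  "mono_subst g \<alpha> = (\<Prod>v\<in>Poly_Mapping.keys \<alpha>. g v ^ Poly_Mapping.lookup \<alpha> v)"

lemma mono_subst_superset:
  assumes "finite S" "Poly_Mapping.keys \<alpha> \<subseteq> S"
  shows "mono_subst g \<alpha> = (\<Prod>v\<in>S. g v ^ Poly_Mapping.lookup \<alpha> v)"
  unfolding mono_subst_def by (rule prod.mono_neutral_left) (use assms in \<open>auto simp: in_keys_iff\<close>)

lemma mono_subst_add: "mono_subst g (\<alpha> + \<beta>) = mono_subst g \<alpha> * mono_subst g \<beta>"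
proof -
  let ?S = "Poly_Mapping.keys \<alpha> \<union> Poly_Mapping.keys \<beta>"
  have "Poly_Mapping.keys (\<alpha> + \<beta>) \<subseteq> ?S"
    by (rule keys_add)
  then show ?thesis
    by (simp add: mono_subst_superset[of ?S] lookup_add prod.distrib power_add)
qed

lemma mono_subst_0 [simp]: "mono_subst g 0 = 1"
  by (simp add: mono_subst_def)

lemma mono_subst_single [simp]: "mono_subst g (Poly_Mapping.single v k) = g v ^ k"
  by (simp add: mono_subst_superset[of "{v}"])

lemma mps_coeff_subst:
  "mps_coeff (mps_subst g f) m = Abs_fls (\<lambda>n. \<Sum>\<alpha> | mps_coeff f \<alpha> * fls_nth (mps_coeff (mono_subst g \<alpha>) m) n \<noteq> 0.
     mps_coeff f \<alpha> * fls_nth (mps_coeff (mono_subst g \<alpha>) m) n)"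
  by (simp add: mps_subst_def Let_def mono_subst_def)

lemma comm_ring_hom_fls_const: "comm_ring_hom (fls_const :: 'a::comm_ring_1 \<Rightarrow> 'a fls)"
  by unfold_locales (simp_all add: fls_plus_const fls_const_mult_const)

text \<open>For a polynomial the coefficientwise sums in the definition of substitution are finite and add up
  to the ordinary evaluation.\<close>

lemma mps_subst_of_mpoly:
  assumes "finite S" "Poly_Mapping.keys P \<subseteq> S"
  shows "mps_subst g (mps_of_mpoly P) =
     (\<Sum>\<alpha>\<in>S. mps_const (fls_const (Poly_Mapping.lookup P \<alpha>)) * mono_subst g \<alpha>)"
proof (rule mps_eqI)
  fix m
  let ?c = "\<lambda>n \<alpha>. Poly_Mapping.lookup P \<alpha> * fls_nth (mps_coeff (mono_subst g \<alpha>) m) n"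
  have "(\<Sum>\<alpha> | ?c n \<alpha> \<noteq> 0. ?c n \<alpha>) = fls_nth (\<Sum>\<alpha>\<in>S. fls_const (Poly_Mapping.lookup P \<alpha>) *
      mps_coeff (mono_subst g \<alpha>) m) n" for n
    unfolding fls_nth_sum fls_mult_const_nth
    by (rule sum.mono_neutral_left)
       (use assms in \<open>auto simp: in_keys_iff subset_iff dest!: mult_not_zero\<close>)
  then show "mps_coeff (mps_subst g (mps_of_mpoly P)) m =
     mps_coeff (\<Sum>\<alpha>\<in>S. mps_const (fls_const (Poly_Mapping.lookup P \<alpha>)) * mono_subst g \<alpha>) m"
    by (simp add: mps_coeff_subst mps_coeff_sum fls_nth_inverse)
qed

lemma mps_subst_of_mpoly_single:
  "mps_subst g (mps_of_mpoly (Poly_Mapping.single \<alpha> a)) = mps_const (fls_const a) * mono_subst g \<alpha>"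
  by (subst mps_subst_of_mpoly[of "{\<alpha>}"]) auto

lemma comm_ring_hom_mps_subst:
  fixes g :: "'v \<Rightarrow> ('u, 'a::comm_ring_1 fls) mps"
  shows "comm_ring_hom (\<lambda>P. mps_subst g (mps_of_mpoly P))"
proof (rule mpoly_additive_imp_hom)
  interpret c: comm_ring_hom "fls_const :: 'a \<Rightarrow> 'a fls"
    by (rule comm_ring_hom_fls_const)
  interpret d: comm_ring_hom "mps_const :: 'a fls \<Rightarrow> ('u, 'a fls) mps"
    by (rule comm_ring_hom_mps_const)
  fix P Q :: "('v, 'a) mpoly"
  let ?S = "Poly_Mapping.keys P \<union> Poly_Mapping.keys Q"
  have "Poly_Mapping.keys (P + Q) \<subseteq> ?S"
    by (rule keys_add)
  then show "mps_subst g (mps_of_mpoly (P + Q)) =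
      mps_subst g (mps_of_mpoly P) + mps_subst g (mps_of_mpoly Q)"
    by (simp add: mps_subst_of_mpoly[of ?S] lookup_add sum.distrib algebra_simps c.hom_add d.hom_add)
next
  fix \<alpha> \<beta> :: "'v \<Rightarrow>\<^sub>0 nat" and a b :: 'a
  show "mps_subst g (mps_of_mpoly (Poly_Mapping.single (\<alpha> + \<beta>) (a * b))) =
      mps_subst g (mps_of_mpoly (Poly_Mapping.single \<alpha> a)) * mps_subst g (mps_of_mpoly (Poly_Mapping.single \<beta> b))"
    by (simp add: mps_subst_of_mpoly_single mono_subst_add mult_ac fls_const_mult_const
        mps_const_mult_const[symmetric] flip: fls_const_mult_const)
next
  show "mps_subst g (mps_of_mpoly 1) = 1"
    using mps_subst_of_mpoly_single[of g 0 1] by simp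
qed

text \<open>The exponent \<open>n\<close> is that of the Laurent variable \<open>z\<^sup>-\<^sup>1\<close>, which thus has weight \<open>1\<close>. The substituted
  expressions \<open>p\<^sub>j - z\<^sup>-\<^sup>j\<close> and \<open>p'\<^sub>j + z\<^sup>-\<^sup>j\<close> are homogeneous of weight \<open>j\<close>.\<close>

definition fls_homogeneous :: "('u \<Rightarrow> nat) \<Rightarrow> nat \<Rightarrow> ('u, 'a::comm_ring_1 fls) mps \<Rightarrow> bool" where
  "fls_homogeneous \<rho> d f \<longleftrightarrow> (\<forall>m n. fls_nth (mps_coeff f m) n \<noteq> 0 \<longrightarrow> n + int (weight \<rho> m) = int d)"

lemma fls_mult_nonzeroE:
  fixes f g :: "'a::comm_ring_1 fls"
  assumes "fls_nth (f * g) n \<noteq> 0"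
  obtains i where "fls_nth f i \<noteq> 0" "fls_nth g (n - i) \<noteq> 0"
proof -
  have "(\<Sum>i=fls_subdegree f..n - fls_subdegree g. fls_nth f i * fls_nth g (n - i)) \<noteq> 0"
    using assms by (simp add: fls_times_nth(2))
  then obtain i where "fls_nth f i * fls_nth g (n - i) \<noteq> 0"
    by (meson sum.neutral)
  then show ?thesis
    using that[of i] mult_not_zero by blast
qed

lemma mps_fls_mult_nonzeroE:
  fixes f g :: "('u, 'a::comm_ring_1 fls) mps"
  assumes "fls_nth (mps_coeff (f * g) m) n \<noteq> 0"
  obtains a b i where "(a, b) \<in> splits m" "fls_nth (mps_coeff f a) i \<noteq> 0"
    "fls_nth (mps_coeff g b) (n - i) \<noteq> 0"
proof -
  have "(\<Sum>w\<in>splits m. fls_nth (mps_coeff f (fst w) * mps_coeff g (snd w)) n) \<noteq> 0"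
    using assms by (simp add: mps_coeff_mult fls_nth_sum case_prod_beta)
  then obtain w where "w \<in> splits m" "fls_nth (mps_coeff f (fst w) * mps_coeff g (snd w)) n \<noteq> 0"
    by (meson sum.neutral)
  then show ?thesis
    using that[of "fst w" "snd w"] by (auto elim!: fls_mult_nonzeroE)
qed

lemma fls_homogeneous_mult:
  assumes "fls_homogeneous \<rho> d f" "fls_homogeneous \<rho> e g"
  shows "fls_homogeneous \<rho> (d + e) (f * g)"
  unfolding fls_homogeneous_def
proof (intro allI impI)
  fix m n
  assume "fls_nth (mps_coeff (f * g) m) n \<noteq> 0"
  then obtain a b i where ab: "(a, b) \<in> splits m" and "fls_nth (mps_coeff f a) i \<noteq> 0"
      "fls_nth (mps_coeff g b) (n - i) \<noteq> 0"
    by (rule mps_fls_mult_nonzeroE)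
  then have "i + int (weight \<rho> a) = int d" "n - i + int (weight \<rho> b) = int e"
    using assms by (auto simp: fls_homogeneous_def)
  then show "n + int (weight \<rho> m) = int (d + e)"
    by (simp add: weight_splits[OF ab])
qed

lemma fls_homogeneous_1: "fls_homogeneous \<rho> 0 1"
  by (auto simp: fls_homogeneous_def mps_coeff_1)

lemma fls_homogeneous_power:
  "fls_homogeneous \<rho> d f \<Longrightarrow> fls_homogeneous \<rho> (d * n) (f ^ n)"
  by (induction n) (auto simp: fls_homogeneous_1 fls_homogeneous_mult)

lemma fls_homogeneous_mono_subst:
  assumes "\<And>v. fls_homogeneous \<rho> (\<rho>' v) (g v)"
  shows "fls_homogeneous \<rho> (weight \<rho>' \<alpha>) (mono_subst g \<alpha>)"
proof -
  have "fls_homogeneous \<rho> (\<Sum>v\<in>S. \<rho>' v * Poly_Mapping.lookup \<alpha> v)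
      (\<Prod>v\<in>S. g v ^ Poly_Mapping.lookup \<alpha> v)" if "finite S" for S
    using that
    by (induction S) (auto simp: fls_homogeneous_1 intro!: fls_homogeneous_mult fls_homogeneous_power assms)
  then show ?thesis
    by (simp add: weight_def mono_subst_def)
qed

text \<open>A weighted homogeneous substitution preserves weights. So a coefficient of the result only involves
  monomials \<open>\<alpha>\<close> of one weight, and the coefficients at very negative powers vanish, which makes the
  use of \<open>Abs_fls\<close> in the definition of substitution legitimate.\<close>

lemma mps_subst_nth:
  assumes "\<And>v. fls_homogeneous \<rho> (\<rho>' v) (g v)"
  shows "fls_nth (mps_coeff (mps_subst g f) m) n =
     (\<Sum>\<alpha> | mps_coeff f \<alpha> * fls_nth (mps_coeff (mono_subst g \<alpha>) m) n \<noteq> 0 \<and>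
        int (weight \<rho>' \<alpha>) = n + int (weight \<rho> m).
        mps_coeff f \<alpha> * fls_nth (mps_coeff (mono_subst g \<alpha>) m) n)"
proof -
  let ?c = "\<lambda>n \<alpha>. mps_coeff f \<alpha> * fls_nth (mps_coeff (mono_subst g \<alpha>) m) n"
  have weight: "int (weight \<rho>' \<alpha>) = n + int (weight \<rho> m)" if "?c n \<alpha> \<noteq> 0" for n \<alpha>
    using that fls_homogeneous_mono_subst[of \<rho> \<rho>' g \<alpha>, OF assms]
    by (auto simp: fls_homogeneous_def dest!: mult_not_zero)
  have neg: "(\<Sum>\<alpha> | ?c n \<alpha> \<noteq> 0. ?c n \<alpha>) = 0" if "n < - int (weight \<rho> m)" for n
    using that weight by (intro sum.neutral) force
  have "fls_nth (mps_coeff (mps_subst g f) m) n = (\<Sum>\<alpha> | ?c n \<alpha> \<noteq> 0. ?c n \<alpha>)"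
    unfolding mps_coeff_subst 
    by (intro nth_Abs_fls_ex_lower_bound exI[of _ "- int (weight \<rho> m)"] allI impI neg)
  then show ?thesis
    using weight by (auto intro!: sum.cong)
qed

lemma mps_subst_nth_neg:
  assumes "\<And>v. fls_homogeneous \<rho> (\<rho>' v) (g v)" "n + int (weight \<rho> m) < 0"
  shows "fls_nth (mps_coeff (mps_subst g f) m) n = 0"
  unfolding mps_subst_nth[OF assms(1)] by (rule sum.neutral) (use assms(2) in auto)

lemma mps_subst_nth_cong:
  assumes "\<And>v. fls_homogeneous \<rho> (\<rho>' v) (g v)"
    and "\<And>\<alpha>. int (weight \<rho>' \<alpha>) = n + int (weight \<rho> m) \<Longrightarrow> mps_coeff f \<alpha> = mps_coeff f' \<alpha>"
  shows "fls_nth (mps_coeff (mps_subst g f) m) n = fls_nth (mps_coeff (mps_subst g f') m) n"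
  unfolding mps_subst_nth[OF assms(1)] by (rule sum.cong) (use assms(2) in auto)

text \<open>Agreement up to total weight \<open>W\<close>, where \<open>z\<^sup>-\<^sup>1\<close> counts with weight \<open>1\<close>. Agreement with \<open>0\<close> up to
  weight \<open>-1\<close> means that all terms have nonnegative total weight.\<close>

definition fls_agree ::
  "('u \<Rightarrow> nat) \<Rightarrow> int \<Rightarrow> ('u, 'a::comm_ring_1 fls) mps \<Rightarrow> ('u, 'a fls) mps \<Rightarrow> bool" where
  "fls_agree \<rho> W f f' \<longleftrightarrow>
     (\<forall>m n. n + int (weight \<rho> m) \<le> W \<longrightarrow> fls_nth (mps_coeff f m) n = fls_nth (mps_coeff f' m) n)"

lemma fls_times_nth_bounds:
  fixes f g :: "'a::comm_ring_1 fls"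
  assumes "\<And>i. i < a \<Longrightarrow> fls_nth f i = 0" "\<And>i. i < b \<Longrightarrow> fls_nth g i = 0"
  shows "fls_nth (f * g) n = (\<Sum>i=a..n - b. fls_nth f i * fls_nth g (n - i))"
proof -
  let ?I = "{a..n - b} \<union> {fls_subdegree f..n - fls_subdegree g}"
  have "fls_nth (f * g) n = (\<Sum>i\<in>?I. fls_nth f i * fls_nth g (n - i))"
    unfolding fls_times_nth(2) by (rule sum.mono_neutral_left) (auto simp: not_le)
  also have "\<dots> = (\<Sum>i=a..n - b. fls_nth f i * fls_nth g (n - i))"
    by (rule sum.mono_neutral_right) (auto simp: not_le assms)
  finally show ?thesis .
qed

text \<open>As the factors have only terms of nonnegative weight, terms of weight at most \<open>W\<close> in a product come
  from terms of weight at most \<open>W\<close> in the factors.\<close>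

lemma fls_agree_mult:
  assumes "fls_agree \<rho> W f f'" "fls_agree \<rho> W g g'"
    and neg: "fls_agree \<rho> (- 1) f 0" "fls_agree \<rho> (- 1) f' 0" "fls_agree \<rho> (- 1) g 0" "fls_agree \<rho> (- 1) g' 0"
  shows "fls_agree \<rho> W (f * g) (f' * g')"
  unfolding fls_agree_def
proof (intro allI impI)
  fix m n
  assume W: "n + int (weight \<rho> m) \<le> W"
  have "fls_nth (mps_coeff f a * mps_coeff g b) n = fls_nth (mps_coeff f' a * mps_coeff g' b) n"
    if ab: "(a, b) \<in> splits m" for a b
  proof -
    let ?A = "- int (weight \<rho> a)" and ?B = "- int (weight \<rho> b)"
    have "fls_nth (mps_coeff f a * mps_coeff g b) n =
        (\<Sum>i=?A..n - ?B. fls_nth (mps_coeff f a) i * fls_nth (mps_coeff g b) (n - i))"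
      by (rule fls_times_nth_bounds) (use neg in \<open>auto simp: fls_agree_def\<close>)
    also have "\<dots> = (\<Sum>i=?A..n - ?B. fls_nth (mps_coeff f' a) i * fls_nth (mps_coeff g' b) (n - i))"
    proof (rule sum.cong[OF refl])
      fix i
      assume "i \<in> {?A..n - ?B}"
      then have "i + int (weight \<rho> a) \<le> W" "n - i + int (weight \<rho> b) \<le> W"
        using W by (auto simp: weight_splits[OF ab])
      then show "fls_nth (mps_coeff f a) i * fls_nth (mps_coeff g b) (n - i) =
          fls_nth (mps_coeff f' a) i * fls_nth (mps_coeff g' b) (n - i)"
        using assms(1,2) by (simp add: fls_agree_def)
    qed
    also have "\<dots> = fls_nth (mps_coeff f' a * mps_coeff g' b) n"
      by (rule fls_times_nth_bounds[symmetric]) (use neg in \<open>auto simp: fls_agree_def\<close>)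
    finally show ?thesis .
  qed
  then show "fls_nth (mps_coeff (f * g) m) n = fls_nth (mps_coeff (f' * g') m) n"
    unfolding mps_coeff_mult fls_nth_sum by (intro sum.cong) auto
qed

section \<open>The determinantal identity behind the bilinear identity\<close>

lemma hom_det_mat:
  fixes h :: "'a::comm_ring_1 \<Rightarrow> 'b::comm_ring_1"
  assumes "comm_ring_hom h"
  shows "h (det (mat n n f)) = det (mat n n (\<lambda>ij. h (f ij)))"
proof -
  interpret comm_ring_hom h by fact
  have "h (det (mat n n f)) = det (map_mat h (mat n n f))"
    by simp
  also have "map_mat h (mat n n f) = mat n n (\<lambda>ij. h (f ij))"
    by (rule eq_matI) auto
  finally show ?thesis .
qed

lemma det_mat_cong:
  assumes "\<And>i j. i < n \<Longrightarrow> j < n \<Longrightarrow> f (i, j) = g (i, j)"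
  shows "det (mat n n f) = det (mat n n g)"
  by (rule arg_cong[of _ _ det], rule eq_matI) (use assms in auto)

text \<open>Subtracting \<open>w\<close> times the preceding column from each column is right multiplication by a
  unitriangular matrix.\<close>

lemma det_column_differences:
  fixes f :: "nat \<Rightarrow> nat \<Rightarrow> 'a::comm_ring_1"
  shows "det (mat n n (\<lambda>(i, c). f i c - (if c = 0 then 0 else w * f i (c - 1)))) =
     det (mat n n (\<lambda>(i, c). f i c))"
proof -
  define Z where "Z = mat n n (\<lambda>(k, c). if k = c then 1 else if Suc k = c then - w else 0)"
  have Z: "Z \<in> carrier_mat n n"
    by (simp add: Z_def)
  have "upper_triangular Z"
    by (auto simp: upper_triangular_def Z_def)
  moreover have "diag_mat Z = replicate n 1"
    by (auto simp: diag_mat_def Z_def intro!: nth_equalityI)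
  ultimately have detZ: "det Z = 1"
    using det_upper_triangular[OF _ Z] by simp
  let ?F = "mat n n (\<lambda>(i, c). f i c)"
  let ?D = "mat n n (\<lambda>(i, c). f i c - (if c = 0 then 0 else w * f i (c - 1)))"
  have "?F * Z = ?D"
  proof (rule eq_matI)
    fix i c
    assume "i < dim_row ?D" "c < dim_col ?D"
    then have i: "i < n" and c: "c < n"
      by simp_all
    have "(?F * Z) $$ (i, c) =
        (\<Sum>k=0..<n. f i k * (if k = c then 1 else if Suc k = c then - w else 0))"
      using i c by (simp add: Z_def scalar_prod_def)
    also have "\<dots> = (\<Sum>k=0..<n. (if k = c then f i k else 0) +
        (if k = c - 1 \<and> c \<noteq> 0 then - (w * f i k) else 0))"
      by (rule sum.cong) auto
    also have "\<dots> = f i c - (if c = 0 then 0 else w * f i (c - 1))"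
      using c by (cases "c = 0") (auto simp: sum.distrib)
    also have "\<dots> = ?D $$ (i, c)"
      using i c by simp
    finally show "(?F * Z) $$ (i, c) = ?D $$ (i, c)" .
  qed (auto simp: Z_def)
  with det_mult[OF mat_carrier Z, of "\<lambda>(i, c). f i c"] show ?thesis
    by (simp add: detZ)
qed

text \<open>The minor, with sign, of the \<open>N \<times> (N + 1)\<close> matrix with columns \<open>u(-1), \<dots>, u(N - 1)\<close> that omits
  the column \<open>u(s - 1)\<close>.\<close>

definition shift_minor :: "nat \<Rightarrow> (nat \<Rightarrow> int \<Rightarrow> 'a::comm_ring_1) \<Rightarrow> nat \<Rightarrow> 'a" where
  "shift_minor N u s =
     (- 1) ^ s * det (mat N N (\<lambda>(j, k). u j (if k < s then int k - 1 else int k)))"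

lemma shift_minor_expansion:
  "det (mat (Suc N) (Suc N) (\<lambda>(i, c). if i = 0 then x c else u (i - 1) (int c - 1))) =
     (\<Sum>s\<le>N. x s * shift_minor N u s)"
  (is "det ?B = _")
proof -
  have "det ?B = (\<Sum>s<Suc N. ?B $$ (0, s) * cofactor ?B 0 s)"
    by (rule laplace_expansion_row[OF mat_carrier]) simp
  also have "\<dots> = (\<Sum>s<Suc N. x s * shift_minor N u s)"
  proof (rule sum.cong[OF refl])
    fix s
    assume s: "s \<in> {..<Suc N}"
    have "mat_delete ?B 0 s = mat N N (\<lambda>(j, k). u j (if k < s then int k - 1 else int k))"
      by (rule eq_matI) (use s in \<open>auto simp: mat_delete_def\<close>)
    then show "?B $$ (0, s) * cofactor ?B 0 s = x s * shift_minor N u s"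
      using s by (simp add: cofactor_def shift_minor_def)
  qed
  finally show ?thesis
    by (simp add: lessThan_Suc_atMost)
qed

text \<open>The expansion of a determinant whose first row repeats the row \<open>j\<close>.\<close>

lemma shift_minor_orthogonal:
  assumes "j < N"
  shows "(\<Sum>s\<le>N. u j (int s - 1) * shift_minor N u s) = 0"
  unfolding shift_minor_expansion[symmetric]
  by (rule det_identical_rows[of _ "Suc N" 0 "Suc j"]) (use assms in \<open>auto simp: row_def\<close>)

text \<open>Border the \<open>N \<times> (N + 1)\<close> matrix of the \<open>u\<^sub>j(k)\<close> by the row \<open>(1, w, \<dots>, w\<^sup>N)\<close>. Column differences
  turn this row into \<open>(1, 0, \<dots>, 0)\<close> and leave the determinant on the left, while expansion along the
  row gives the sum on the right.\<close>

lemma det_shifted_columns: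
  "det (mat N N (\<lambda>(j, k). u j (int k) - w * u j (int k - 1))) = (\<Sum>s\<le>N. w ^ s * shift_minor N u s)"
proof -
  let ?f = "\<lambda>i c. if i = 0 then w ^ c else u (i - 1) (int c - 1)"
  let ?D = "mat (Suc N) (Suc N) (\<lambda>(i, c). ?f i c - (if c = 0 then 0 else w * ?f i (c - 1)))"
  have "(\<Sum>s\<le>N. w ^ s * shift_minor N u s) = det ?D"
    unfolding shift_minor_expansion[symmetric] by (rule det_column_differences[symmetric])
  also have "\<dots> = (\<Sum>s<Suc N. ?D $$ (0, s) * cofactor ?D 0 s)"
    by (rule laplace_expansion_row[OF mat_carrier]) simp
  also have "\<dots> = (\<Sum>s<Suc N. if s = 0 then cofactor ?D 0 0 else 0)"
    by (rule sum.cong) (auto simp: gr0_conv_Suc)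
  also have "\<dots> = det (mat_delete ?D 0 0)"
    by (simp add: cofactor_def)
  also have "mat_delete ?D 0 0 = mat N N (\<lambda>(j, k). u j (int k) - w * u j (int k - 1))"
    by (rule eq_matI) (auto simp: mat_delete_def)
  finally show ?thesis ..
qed

text \<open>The cofactor of the entry \<open>j\<close> of the first column in the matrix \<open>(v\<^sub>j(k))\<close>; that column itself,
  \<open>k = 0\<close>, does not enter.\<close>

definition column_cofactor :: "nat \<Rightarrow> (nat \<Rightarrow> int \<Rightarrow> 'a::comm_ring_1) \<Rightarrow> nat \<Rightarrow> 'a" where
  "column_cofactor N v j =
     (- 1) ^ j * det (mat (N - 1) (N - 1) (\<lambda>(i, k). v (if i < j then i else Suc i) (int k + 1)))"

lemma column_cofactor_expansion:
  assumes "N > 0"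
  shows "det (mat N N (\<lambda>(j, k). if k = 0 then x j else v j (int k))) =
     (\<Sum>j<N. x j * column_cofactor N v j)" (is "det ?B = _")
proof -
  have "det ?B = (\<Sum>j<N. ?B $$ (j, 0) * cofactor ?B j 0)"
    by (rule laplace_expansion_column[OF mat_carrier]) (use assms in simp)
  also have "\<dots> = (\<Sum>j<N. x j * column_cofactor N v j)"
  proof (rule sum.cong[OF refl])
    fix j
    assume j: "j \<in> {..<N}"
    have "mat_delete ?B j 0 = mat (N - 1) (N - 1) (\<lambda>(i, k). v (if i < j then i else Suc i) (int k + 1))"
      by (rule eq_matI) (use j in \<open>auto simp: mat_delete_def add.commute\<close>)
    then show "?B $$ (j, 0) * cofactor ?B j 0 = x j * column_cofactor N v j"
      using j by (simp add: cofactor_def column_cofactor_def)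
  qed
  finally show ?thesis .
qed

text \<open>The expansion of a determinant whose first column repeats the column \<open>k\<close>.\<close>

lemma column_cofactor_orthogonal:
  assumes "0 < k" "k < N"
  shows "(\<Sum>j<N. v j (int k) * column_cofactor N v j) = 0"
proof -
  have "N > 0" using assms by simp
  show ?thesis
    unfolding column_cofactor_expansion[OF \<open>N > 0\<close>, symmetric]
    by (rule det_identical_columns[of _ N 0 k]) (use assms in \<open>auto simp: col_def\<close>)
qed

text \<open>In the application \<open>g\<^sub>j(k) = (\<Sum>r\<ge>0. w\<^sup>r v\<^sub>j(k - r))\<close>; column differences reduce all columns of \<open>g\<close>
  except the first to those of \<open>v\<close>.\<close>

lemma det_geometric_columns:
  assumes "N > 0" and "\<And>j k. j < N \<Longrightarrow> v j k = g j k - w * g j (k - 1)"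
  shows "det (mat N N (\<lambda>(j, k). g j (int k))) = (\<Sum>j<N. g j 0 * column_cofactor N v j)"
proof -
  have "det (mat N N (\<lambda>(j, k). g j (int k))) =
      det (mat N N (\<lambda>(j, k). g j (int k) - (if k = 0 then 0 else w * g j (int (k - 1)))))"
    by (rule det_column_differences[symmetric])
  also have "\<dots> = det (mat N N (\<lambda>(j, k). if k = 0 then g j 0 else v j (int k)))"
    by (rule det_mat_cong) (auto simp: assms(2) of_nat_diff)
  also have "\<dots> = (\<Sum>j<N. g j 0 * column_cofactor N v j)"
    by (rule column_cofactor_expansion[OF assms(1)])
  finally show ?thesis .
qed

text \<open>The left-hand side will be the coefficient of \<open>z\<^sup>-\<^sup>1\<close> in the bilinear identity, with \<open>c\<^sub>i\<close> the
  coefficient of \<open>z\<^sup>i\<close> in the exponential. For fixed \<open>s\<close>, the sum over \<open>r\<close> is a part of the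
  convolution that expresses \<open>u\<^sub>j(s - 1)\<close>. The missing terms involve \<open>v(1), \<dots>, v(s - 1)\<close>, to
  which the cofactors are orthogonal. So the sum over \<open>r\<close> can be replaced by \<open>u\<^sub>j(s - 1)\<close>, and then
  the minors are orthogonal to the row \<open>j\<close>.\<close>

lemma determinantal_bilinear_identity:
  fixes u v :: "nat \<Rightarrow> int \<Rightarrow> 'a::comm_ring_1"
  assumes c: "\<And>i. i < 0 \<Longrightarrow> c i = 0"
    and v: "\<And>j k. j < N \<Longrightarrow> k < - int R \<Longrightarrow> v j k = 0"
    and uv: "\<And>j k. j < N \<Longrightarrow> - 1 \<le> k \<Longrightarrow> k < int N \<Longrightarrow> u j k = (\<Sum>l\<le>N + R. c (int l) * v j (k - int l))"
  shows "(\<Sum>s\<le>N. \<Sum>r\<le>R. c (int (s + r) - 1) *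
     (shift_minor N u s * (\<Sum>j<N. v j (- int r) * column_cofactor N v j))) = 0"
proof -
  let ?e = "column_cofactor N v"
  have step: "(\<Sum>r\<le>R. c (int (s + r) - 1) * (\<Sum>j<N. v j (- int r) * ?e j)) =
      (\<Sum>j<N. u j (int s - 1) * ?e j)" if s: "s \<le> N" for s
  proof -
    \<comment> \<open>\<open>V k\<close> is the determinant of \<open>v\<close> with its first column replaced by the column \<open>k\<close>.\<close>
    define V where "V k = (\<Sum>j<N. v j k * ?e j)" for k
    have V0: "V k = 0" if "k < - int R \<or> (0 < k \<and> k < int N)" for k
    proof (cases "k < 0")
      case False
      then show ?thesis
        using that column_cofactor_orthogonal[of "nat k" N v] by (auto simp: V_def)
    qed (use that v in \<open>auto simp: V_def\<close>)
    have "(\<Sum>j<N. u j (int s - 1) * ?e j) =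
        (\<Sum>j<N. \<Sum>l\<le>N + R. c (int l) * (v j (int s - 1 - int l) * ?e j))"
      using s by (intro sum.cong) (auto simp: uv sum_distrib_right mult.assoc)
    also have "\<dots> = (\<Sum>l\<le>N + R. c (int l) * V (int s - 1 - int l))"
      unfolding V_def sum_distrib_left by (rule sum.swap)
    also have "\<dots> = (\<Sum>i\<in>{0..int (N + R)}. c i * V (int s - 1 - i))"
      by (rule sum.reindex_bij_witness[of _ nat int]) auto
    also have "\<dots> = (\<Sum>i\<in>{int s - 1..int s - 1 + int R}. c i * V (int s - 1 - i))"
    proof (rule sum.mono_neutral_cong)
      fix i
      assume "i \<in> {0..int (N + R)} - {int s - 1..int s - 1 + int R}"
      then have "V (int s - 1 - i) = 0"
        using s by (intro V0) auto
      then show "c i * V (int s - 1 - i) = 0"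
        by simp
    next
      fix i
      assume "i \<in> {int s - 1..int s - 1 + int R} - {0..int (N + R)}"
      then show "c i * V (int s - 1 - i) = 0"
        using s c[of i] by auto
    qed auto
    also have "\<dots> = (\<Sum>r\<le>R. c (int (s + r) - 1) * V (- int r))"
      by (rule sum.reindex_bij_witness[of _ "\<lambda>r. int (s + r) - 1" "\<lambda>i. nat (i + 1 - int s)"])
         (auto simp: algebra_simps)
    finally show ?thesis
      by (simp add: V_def)
  qed
  have "(\<Sum>s\<le>N. \<Sum>r\<le>R. c (int (s + r) - 1) * (shift_minor N u s * (\<Sum>j<N. v j (- int r) * ?e j))) =
      (\<Sum>s\<le>N. shift_minor N u s * (\<Sum>r\<le>R. c (int (s + r) - 1) * (\<Sum>j<N. v j (- int r) * ?e j)))"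
    by (simp add: sum_distrib_left mult_ac)
  also have "\<dots> = (\<Sum>s\<le>N. shift_minor N u s * (\<Sum>j<N. u j (int s - 1) * ?e j))"
    by (intro sum.cong[OF refl] arg_cong2[of _ _ _ _ "(*)"] step) auto
  also have "\<dots> = (\<Sum>j<N. \<Sum>s\<le>N. ?e j * (u j (int s - 1) * shift_minor N u s))"
    unfolding sum_distrib_left by (subst sum.swap) (simp add: mult_ac)
  also have "\<dots> = (\<Sum>j<N. ?e j * (\<Sum>s\<le>N. u j (int s - 1) * shift_minor N u s))"
    by (simp only: sum_distrib_left)
  also have "\<dots> = 0"
    by (simp add: shift_minor_orthogonal)
  finally show ?thesis .
qed

section \<open>The Cauchy--Binet formula\<close>

text \<open>These lists represent the \<open>N\<close>-element subsets of \<open>I\<close>. The decreasing order is the one in which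
  partitions list their shifted parts.\<close>

definition decreasing_lists :: "nat \<Rightarrow> 'i::linorder set \<Rightarrow> 'i list set" where
  "decreasing_lists N I = {s. sorted_wrt (>) s \<and> length s = N \<and> set s \<subseteq> I}"

lemma distinct_decreasing: "sorted_wrt (>) s \<Longrightarrow> distinct (s :: 'i::linorder list)"
  by (induction s) auto

lemma decreasing_list_unique:
  fixes s t :: "'i::linorder list"
  assumes "sorted_wrt (>) s" "sorted_wrt (>) t" "set s = set t"
  shows "s = t"
proof -
  have "sorted_wrt (<) (rev s)" "sorted_wrt (<) (rev t)"
    using assms by (simp_all add: sorted_wrt_rev)
  then have "rev s = rev t"
    by (intro strict_sorted_equal) (use assms(3) in auto)
  then show ?thesis
    by simp
qed

text \<open>An injection is an image set, listed in decreasing order, together with a permutation.\<close>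

lemma bij_betw_injections_decreasing:
  fixes I :: "'i::linorder set"
  assumes "finite I"
  shows "bij_betw (\<lambda>(s, p). \<lambda>j\<in>{0..<N}. s ! p j)
     (decreasing_lists N I \<times> {p. p permutes {0..<N}})
     {g \<in> {0..<N} \<rightarrow>\<^sub>E I. inj_on g {0..<N}}"
  unfolding bij_betw_def
proof (intro conjI)
  let ?D = "decreasing_lists N I" and ?P = "{p. p permutes {0..<N}}"
  let ?f = "\<lambda>(s, p). \<lambda>j\<in>{0..<N}. s ! p j" and ?U = "{0..<N}"
  have img: "(\<lambda>j\<in>?U. s ! p j) ` ?U = set s" if "s \<in> ?D" "p permutes ?U" for s :: "'i list" and p
  proof -
    have "(\<lambda>j\<in>?U. s ! p j) ` ?U = (\<lambda>j. s ! j) ` p ` ?U"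
      by (auto simp: image_image)
    also have "\<dots> = set s"
      using that by (auto simp: permutes_image decreasing_lists_def set_conv_nth)
    finally show ?thesis .
  qed
  show "inj_on ?f (?D \<times> ?P)"
  proof (rule inj_onI, clarify)
    fix s t :: "'i list" and p q
    assume s: "s \<in> ?D" and t: "t \<in> ?D" and p: "p permutes ?U" and q: "q permutes ?U"
      and eq: "(\<lambda>j\<in>?U. s ! p j) = (\<lambda>j\<in>?U. t ! q j)"
    have "set s = set t"
      using img[OF s p] img[OF t q] eq by simp
    then have st: "s = t"
      using s t by (intro decreasing_list_unique) (auto simp: decreasing_lists_def)
    have "p j = q j" for j
    proof (cases "j \<in> ?U")
      case True
      then have "s ! p j = s ! q j"
        using fun_cong[OF eq, of j] by (simp add: st)
      moreover have "p j < length s" "q j < length s"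
        using True s permutes_in_image[OF p, of j] permutes_in_image[OF q, of j]
        by (auto simp: decreasing_lists_def)
      ultimately show ?thesis
        using distinct_decreasing[of s] s by (auto simp: decreasing_lists_def nth_eq_iff_index_eq)
    next
      case False
      then show ?thesis
        using p q by (simp add: permutes_not_in)
    qed
    with st show "s = t \<and> p = q"
      by auto
  qed
  show "?f ` (?D \<times> ?P) = {g \<in> ?U \<rightarrow>\<^sub>E I. inj_on g ?U}"
  proof (intro equalityI subsetI)
    fix g
    assume "g \<in> ?f ` (?D \<times> ?P)"
    then obtain s p where s: "s \<in> ?D" and p: "p permutes ?U" and g: "g = (\<lambda>j\<in>?U. s ! p j)"
      by auto
    have "g ` ?U \<subseteq> I"
      using img[OF s p] s by (auto simp: g decreasing_lists_def)
    then have "g \<in> ?U \<rightarrow>\<^sub>E I"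
      by (auto simp: g)
    moreover have "inj_on g ?U"
    proof (rule eq_card_imp_inj_on)
      have "g ` ?U = set s"
        unfolding g by (rule img[OF s p])
      moreover have "card (set s) = N"
        using s distinct_decreasing[of s] by (auto simp: decreasing_lists_def distinct_card)
      ultimately show "card (g ` ?U) = card ?U"
        by simp
    qed simp
    ultimately show "g \<in> {g \<in> ?U \<rightarrow>\<^sub>E I. inj_on g ?U}"
      by simp
  next
    fix g
    assume "g \<in> {g \<in> ?U \<rightarrow>\<^sub>E I. inj_on g ?U}"
    then have g: "g \<in> ?U \<rightarrow>\<^sub>E I" and inj: "inj_on g ?U"
      by auto
    \<comment> \<open>\<open>s\<close> lists the image of \<open>g\<close>, and \<open>p j\<close> is the position of \<open>g j\<close> in this list.\<close>
    define s where "s = rev (sorted_list_of_set (g ` ?U))"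
    have s: "s \<in> ?D"
      using g inj by (auto simp: decreasing_lists_def s_def sorted_wrt_rev card_image PiE_def Pi_def)
    have set_s: "set s = g ` ?U" and len: "length s = N"
      using s by (auto simp: s_def decreasing_lists_def)
    have bij_s: "bij_betw (\<lambda>j. s ! j) ?U (g ` ?U)"
      using bij_betw_nth[of s "{..<N}" "g ` ?U"] s set_s len distinct_decreasing[of s]
      by (auto simp: decreasing_lists_def lessThan_atLeast0)
    define p where "p j = (if j \<in> ?U then the_inv_into ?U (\<lambda>j. s ! j) (g j) else j)" for j
    have "bij_betw (the_inv_into ?U (\<lambda>j. s ! j) \<circ> g) ?U ?U"
      by (rule bij_betw_trans[OF inj_on_imp_bij_betw[OF inj] bij_betw_the_inv_into[OF bij_s]])
    then have "bij_betw p ?U ?U"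
      by (rule bij_betw_cong[THEN iffD1, rotated]) (simp add: p_def)
    then have p: "p permutes ?U"
      by (rule bij_imp_permutes) (simp add: p_def)
    have "g = (\<lambda>j\<in>?U. s ! p j)"
    proof
      fix j
      show "g j = (\<lambda>j\<in>?U. s ! p j) j"
        using g f_the_inv_into_f_bij_betw[OF bij_s, of "g j"] by (auto simp: p_def PiE_def extensional_def)
    qed
    with s p show "g \<in> ?f ` (?D \<times> ?P)"
      by auto
  qed
qed

text \<open>Expand the determinant on the left multilinearly in its rows. Each row selects an index, a
  selection with a repetition contributes zero, and the injective selections are grouped by their
  image.\<close>

theorem Cauchy_Binet:
  fixes a b :: "'i::linorder \<Rightarrow> nat \<Rightarrow> 'a::comm_ring_1"
  assumes "finite I"
  shows "det (mat N N (\<lambda>(j, k). \<Sum>l\<in>I. a l j * b l k)) =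
     (\<Sum>s\<in>decreasing_lists N I. det (mat N N (\<lambda>(i, j). a (s ! i) j)) * det (mat N N (\<lambda>(i, k). b (s ! i) k)))"
proof -
  let ?U = "{0..<N}"
  let ?P = "{p. p permutes ?U}"
  let ?b = "\<lambda>g. det (mat N N (\<lambda>(j, k). b (g j) k))"
  have "det (mat N N (\<lambda>(j, k). \<Sum>l\<in>I. a l j * b l k)) =
      (\<Sum>p\<in>?P. signof p * (\<Prod>j\<in>?U. \<Sum>l\<in>I. a l j * b l (p j)))"
    unfolding det_def'[OF mat_carrier]
    by (intro sum.cong[OF refl] arg_cong2[of _ _ _ _ "(*)"] prod.cong)
       (auto simp: permutes_in_image)
  also have "\<dots> = (\<Sum>p\<in>?P. \<Sum>g\<in>?U \<rightarrow>\<^sub>E I. signof p * (\<Prod>j\<in>?U. a (g j) j * b (g j) (p j)))"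
    by (subst prod_sum_PiE) (auto simp: assms sum_distrib_left)
  also have "\<dots> = (\<Sum>g\<in>?U \<rightarrow>\<^sub>E I. \<Sum>p\<in>?P. (\<Prod>j\<in>?U. a (g j) j) * (signof p * (\<Prod>j\<in>?U. b (g j) (p j))))"
    by (subst sum.swap) (simp add: prod.distrib mult_ac)
  also have "\<dots> = (\<Sum>g\<in>?U \<rightarrow>\<^sub>E I. (\<Prod>j\<in>?U. a (g j) j) * ?b g)"
    unfolding det_def'[OF mat_carrier] sum_distrib_left
    by (intro sum.cong[OF refl] arg_cong2[of _ _ _ _ "(*)"] prod.cong)
       (auto simp: permutes_in_image)
  also have "\<dots> = (\<Sum>g\<in>{g \<in> ?U \<rightarrow>\<^sub>E I. inj_on g ?U}. (\<Prod>j\<in>?U. a (g j) j) * ?b g)"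
  proof (rule sum.mono_neutral_right)
    show "\<forall>g\<in>(?U \<rightarrow>\<^sub>E I) - {g \<in> ?U \<rightarrow>\<^sub>E I. inj_on g ?U}. (\<Prod>j\<in>?U. a (g j) j) * ?b g = 0"
    proof
      fix g
      assume "g \<in> (?U \<rightarrow>\<^sub>E I) - {g \<in> ?U \<rightarrow>\<^sub>E I. inj_on g ?U}"
      then obtain i j where "i < N" "j < N" "i \<noteq> j" "g i = g j"
        by (auto simp: inj_on_def)
      then have "?b g = 0"
        by (intro det_identical_rows[of _ N i j]) (auto simp: row_def)
      then show "(\<Prod>j\<in>?U. a (g j) j) * ?b g = 0"
        by simp
    qed
  qed (auto simp: assms finite_PiE)
  also have "\<dots> = (\<Sum>(s, p)\<in>decreasing_lists N I \<times> ?P.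
      (\<Prod>j\<in>?U. a (s ! p j) j) * ?b (\<lambda>j. s ! p j))"
    unfolding sum.reindex_bij_betw[OF bij_betw_injections_decreasing[OF assms], symmetric]
    by (rule sum.cong[OF refl])
       (auto intro!: arg_cong2[of _ _ _ _ "(*)"] arg_cong[of _ _ det] prod.cong eq_matI)
  also have "\<dots> = (\<Sum>s\<in>decreasing_lists N I. \<Sum>p\<in>?P.
      (signof p * (\<Prod>j\<in>?U. a (s ! p j) j)) * ?b (\<lambda>j. s ! j))"
    unfolding sum.cartesian_product[symmetric]
  proof (intro sum.cong[OF refl])
    fix s p
    assume "p \<in> ?P"
    then have p: "p permutes ?U"
      by simp
    have "?b (\<lambda>j. s ! p j) = det (mat N N (\<lambda>(i, j). mat N N (\<lambda>(i, k). b (s ! i) k) $$ (p i, j)))"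
      using permutes_in_image[OF p] by (intro arg_cong[of _ _ det] eq_matI) auto
    also have "\<dots> = signof p * ?b (\<lambda>j. s ! j)"
      by (rule det_permute_rows[OF mat_carrier p])
    finally show "(\<Prod>j\<in>?U. a (s ! p j) j) * ?b (\<lambda>j. s ! p j) =
        (signof p * (\<Prod>j\<in>?U. a (s ! p j) j)) * ?b (\<lambda>j. s ! j)"
      by simp
  qed
  also have "\<dots> = (\<Sum>s\<in>decreasing_lists N I.
      det (mat N N (\<lambda>(i, j). a (s ! i) j)) * ?b (\<lambda>j. s ! j))"
  proof (intro sum.cong[OF refl])
    fix s
    have "det (mat N N (\<lambda>(i, j). a (s ! i) j)) = (\<Sum>p\<in>?P. signof p * (\<Prod>j\<in>?U. a (s ! p j) j))"
      unfolding det_col[OF mat_carrier] lessThan_atLeast0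
      by (intro sum.cong[OF refl] arg_cong2[of _ _ _ _ "(*)"] prod.cong) (auto simp: permutes_in_image)
    then show "(\<Sum>p\<in>?P. (signof p * (\<Prod>j\<in>?U. a (s ! p j) j)) * ?b (\<lambda>j. s ! j)) =
        det (mat N N (\<lambda>(i, j). a (s ! i) j)) * ?b (\<lambda>j. s ! j)"
      by (simp add: sum_distrib_right)
  qed
  finally show ?thesis .
qed

section \<open>The bilinear identity for finite determinants\<close>

definition mps_map :: "('a::comm_ring_1 \<Rightarrow> 'b::comm_ring_1) \<Rightarrow> ('v, 'a) mps \<Rightarrow> ('v, 'b) mps" where
  "mps_map h f = Abs_mps (\<lambda>m. h (mps_coeff f m))"

lemma mps_coeff_map [simp]: "mps_coeff (mps_map h f) m = h (mps_coeff f m)"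
  by (simp add: mps_map_def)

lemma comm_ring_hom_mps_map:
  fixes h :: "'a::comm_ring_1 \<Rightarrow> 'b::comm_ring_1"
  assumes "comm_ring_hom h"
  shows "comm_ring_hom (mps_map h :: ('v, 'a) mps \<Rightarrow> ('v, 'b) mps)"
proof -
  interpret comm_ring_hom h by fact
  show ?thesis
    by unfold_locales
       (auto intro!: mps_eqI simp: mps_coeff_1 mps_coeff_mult hom_add hom_sum hom_mult case_prod_beta)
qed

text \<open>Here \<open>F\<close> is the series \<open>B\<close> evaluated at \<open>t = z\<close>. For an infinite series this makes sense
  because the coefficient of \<open>t\<^sup>k\<close> is homogeneous of weight \<open>k\<close>, so that each monomial meets a single
  power of \<open>z\<close>.\<close>

definition graded_at_z ::
  "('u \<Rightarrow> nat) \<Rightarrow> ('u, 'a::comm_ring_1) mps fps \<Rightarrow> ('u, 'a fls) mps \<Rightarrow> bool" where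
  "graded_at_z \<rho> B F \<longleftrightarrow>
     (\<forall>m k. k \<noteq> weight \<rho> m \<longrightarrow> mps_coeff (B $ k) m = 0) \<and>
     (\<forall>m. mps_coeff F m = fls_shift (int (weight \<rho> m)) (fls_const (mps_coeff (B $ weight \<rho> m) m)))"

lemma graded_at_z_1: "graded_at_z \<rho> 1 1"
  by (auto simp: graded_at_z_def mps_coeff_1)

lemma graded_at_z_mult:
  assumes "graded_at_z \<rho> B F" "graded_at_z \<rho> C G"
  shows "graded_at_z \<rho> (B * C) (F * G)"
proof -
  have prod: "mps_coeff ((B * C) $ k) m = (if k = weight \<rho> m then
      (\<Sum>(a, b)\<in>splits m. mps_coeff (B $ weight \<rho> a) a * mps_coeff (C $ weight \<rho> b) b) else 0)" for k m
  proof -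
    have "mps_coeff ((B * C) $ k) m =
        (\<Sum>(a, b)\<in>splits m. \<Sum>i=0..k. mps_coeff (B $ i) a * mps_coeff (C $ (k - i)) b)"
      unfolding fps_mult_nth mps_coeff_sum mps_coeff_mult case_prod_beta by (rule sum.swap)
    also have "\<dots> = (\<Sum>(a, b)\<in>splits m. if k = weight \<rho> m
        then mps_coeff (B $ weight \<rho> a) a * mps_coeff (C $ weight \<rho> b) b else 0)"
    proof (rule sum.cong[OF refl], clarify)
      fix a b
      assume ab: "(a, b) \<in> splits m"
      have "(\<Sum>i=0..k. mps_coeff (B $ i) a * mps_coeff (C $ (k - i)) b) =
          (\<Sum>i=0..k. if i = weight \<rho> a then (if k = weight \<rho> m
            then mps_coeff (B $ weight \<rho> a) a * mps_coeff (C $ weight \<rho> b) b else 0) else 0)"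
        by (rule sum.cong) (use assms in \<open>auto simp: graded_at_z_def weight_splits[OF ab]\<close>)
      then show "(\<Sum>i=0..k. mps_coeff (B $ i) a * mps_coeff (C $ (k - i)) b) = (if k = weight \<rho> m
          then mps_coeff (B $ weight \<rho> a) a * mps_coeff (C $ weight \<rho> b) b else 0)"
        by (auto simp: weight_splits[OF ab])
    qed
    finally show ?thesis
      by (simp add: case_prod_beta)
  qed
  have "mps_coeff (F * G) m = fls_shift (int (weight \<rho> m)) (fls_const (mps_coeff ((B * C) $ weight \<rho> m) m))" for m
  proof -
    interpret comm_ring_hom "fls_const :: 'b \<Rightarrow> 'b fls"
      by (rule comm_ring_hom_fls_const)
    have "mps_coeff (F * G) m = (\<Sum>(a, b)\<in>splits m. fls_shift (int (weight \<rho> m))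
        (fls_const (mps_coeff (B $ weight \<rho> a) a * mps_coeff (C $ weight \<rho> b) b)))"
      unfolding mps_coeff_mult
    proof (rule sum.cong[OF refl], clarify)
      fix a b
      assume ab: "(a, b) \<in> splits m"
      show "mps_coeff F a * mps_coeff G b = fls_shift (int (weight \<rho> m))
          (fls_const (mps_coeff (B $ weight \<rho> a) a * mps_coeff (C $ weight \<rho> b) b))"
        using assms by (simp add: graded_at_z_def fls_times_both_shifted_simp weight_splits[OF ab])
    qed
    also have "\<dots> = fls_shift (int (weight \<rho> m)) (fls_const (mps_coeff ((B * C) $ weight \<rho> m) m))"
      by (rule fls_eqI) (simp add: prod fls_nth_sum case_prod_beta)
    finally show ?thesis .
  qed
  with prod show ?thesis
    by (auto simp: graded_at_z_def)
qed

lemma graded_at_z_power: "graded_at_z \<rho> B F \<Longrightarrow> graded_at_z \<rho> (B ^ n) (F ^ n)"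
  by (induction n) (auto simp: graded_at_z_1 graded_at_z_mult)

lemma graded_at_z_exp:
  fixes B :: "('u, 'a::comm_rat_algebra) mps fps"
  assumes rep: "graded_at_z \<rho> B F" and B0: "B $ 0 = 0" and pos: "\<And>v. \<rho> v > 0"
  shows "graded_at_z \<rho> (exp_series oo B) (mps_exp F)"
proof -
  have F0: "mps_coeff F 0 = 0"
    using rep B0 by (simp add: graded_at_z_def)
  have coeff: "mps_coeff ((exp_series oo B) $ k) m = (\<Sum>i=0..k. recip (fact i) * mps_coeff (B ^ i $ k) m)" for k m
    by (simp add: fps_compose_nth exp_series_def mps_coeff_sum recip_mps)
  have "mps_coeff (mps_exp F) m = fls_shift (int (weight \<rho> m)) (fls_const (mps_coeff ((exp_series oo B) $ weight \<rho> m) m))" for m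
  proof -
    have "mps_coeff (mps_exp F) m = (\<Sum>i=0..weight \<rho> m. mps_coeff (recip (fact i) * F ^ i) m)"
      unfolding mps_exp_def
      by (rule mps_coeff_mps_sum) (auto simp: recip_mps mps_coeff_power_eq_0[of F \<rho>, OF F0 pos])
    also have "\<dots> = (\<Sum>i=0..weight \<rho> m. fls_const (recip (fact i)) *
        fls_shift (int (weight \<rho> m)) (fls_const (mps_coeff (B ^ i $ weight \<rho> m) m)))"
      using graded_at_z_power[OF rep]
      by (simp add: recip_mps recip_hom[OF comm_ring_hom_fls_const] graded_at_z_def)
    also have "\<dots> = fls_shift (int (weight \<rho> m)) (fls_const (mps_coeff ((exp_series oo B) $ weight \<rho> m) m))"
      by (rule fls_eqI) (simp add: coeff fls_nth_sum)
    finally show ?thesis .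
  qed
  moreover have "mps_coeff ((exp_series oo B) $ k) m = 0" if "k \<noteq> weight \<rho> m" for k m
    using graded_at_z_power[OF rep] that by (simp add: coeff graded_at_z_def)
  ultimately show ?thesis
    by (simp add: graded_at_z_def)
qed

abbreviation kp_weight :: "nat + nat \<Rightarrow> nat" where
  "kp_weight \<equiv> case_sum Suc Suc"

lemma kp_weight_pos: "kp_weight v > 0"
  by (cases v) auto

definition kp_exponential :: "'k::comm_rat_algebra kp_ring" where
  "kp_exponential = mps_exp (mps_sum (\<lambda>i. recip i * (kp_p i - kp_p' i) * kp_z ^ i) {1..})"

text \<open>The variables \<open>p\<^sub>j\<close> and \<open>p'\<^sub>j\<close> in the subring of series without \<open>z\<close>, to which the coefficients of the
  powers of \<open>z\<close> belong; \<open>zconst\<close> below is its inclusion.\<close>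

definition xvar :: "nat \<Rightarrow> (nat + nat, 'k::comm_ring_1) mps" where
  "xvar j = mps_var (Inl (j - 1))"

definition xvar' :: "nat \<Rightarrow> (nat + nat, 'k::comm_ring_1) mps" where
  "xvar' j = mps_var (Inr (j - 1))"

abbreviation zconst :: "(nat + nat, 'k::comm_ring_1) mps \<Rightarrow> 'k kp_ring" where
  "zconst \<equiv> mps_map fls_const"

lemma zconst_xvar: "zconst (xvar j) = kp_p j" "zconst (xvar' j) = kp_p' j"
  by (auto intro!: mps_eqI simp: xvar_def xvar'_def kp_p_def kp_p'_def mps_coeff_var)

lemma mps_const_power: "mps_const c ^ n = (mps_const (c ^ n) :: ('v, 'a::comm_ring_1) mps)"
proof -
  interpret comm_ring_hom "mps_const :: 'a \<Rightarrow> ('v, 'a) mps"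
    by (rule comm_ring_hom_mps_const)
  show ?thesis by (simp add: hom_power)
qed

text \<open>In other words, the exponential is \<open>\<Sum>n. h\<^sub>n(p - p') * z\<^sup>n\<close>.\<close>

lemma graded_at_z_kp_exponential:
  "graded_at_z kp_weight (complete_series (\<lambda>j. xvar j - xvar' j)) (kp_exponential :: 'k::comm_rat_algebra kp_ring)"
proof -
  let ?B = "Abs_fps (\<lambda>k. if k = 0 then 0 else recip k * (xvar k - xvar' k)) :: (nat + nat, 'k) mps fps"
  let ?x = "\<lambda>i. xvar i - xvar' i :: (nat + nat, 'k) mps"
  let ?t = "\<lambda>i. recip i * (kp_p i - kp_p' i) * kp_z ^ i :: 'k kp_ring"
  have x: "mps_coeff (?x k) m = 0" if "k > 0" "k \<noteq> weight kp_weight m" for k m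
    using that by (auto simp: xvar_def xvar'_def mps_coeff_var)
  have kp: "mps_coeff (kp_p k - kp_p' k) m = fls_const (mps_coeff (?x k) m)" for k m
    by (simp add: zconst_xvar[symmetric] fls_minus_const)
  have t: "mps_coeff (?t k) m = fls_const (recip k * mps_coeff (?x k) m) * fls_X_inv ^ k" if "k > 0" for k m
  proof -
    have "?t k = mps_const (fls_const (recip k) * fls_X_inv ^ k) * (kp_p k - kp_p' k)"
      using that by (simp add: recip_mps recip_hom[OF comm_ring_hom_fls_const] mps_const_power
          mps_const_mult_const[symmetric] mult_ac)
    then show ?thesis
      by (simp only: mps_coeff_const_mult kp) (simp add: mult_ac flip: fls_const_mult_const)
  qed
  have "graded_at_z kp_weight ?B (mps_sum ?t {1..})"
    unfolding graded_at_z_def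
  proof (intro conjI allI impI)
    fix m :: "nat + nat \<Rightarrow>\<^sub>0 nat" and k
    assume "k \<noteq> weight kp_weight m"
    then show "mps_coeff (?B $ k) m = 0"
      using x[of k m] by (simp add: recip_mps)
  next
    fix m :: "nat + nat \<Rightarrow>\<^sub>0 nat"
    have "mps_coeff (mps_sum ?t {1..}) m = (\<Sum>i\<in>{weight kp_weight m} \<inter> {1..}. mps_coeff (?t i) m)"
      by (rule mps_coeff_mps_sum) (auto simp del: mps_coeff_diff simp: t x)
    also have "\<dots> = fls_shift (int (weight kp_weight m)) (fls_const (mps_coeff (?B $ weight kp_weight m) m))"
    proof (cases "weight kp_weight m = 0")
      case False
      then have "(\<Sum>i\<in>{weight kp_weight m} \<inter> {1..}. mps_coeff (?t i) m) = mps_coeff (?t (weight kp_weight m)) m"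
        by simp
      also have "\<dots> = fls_shift (int (weight kp_weight m)) (fls_const (mps_coeff (?B $ weight kp_weight m) m))"
        using False by (simp only: t) (simp add: recip_mps fls_X_inv_power_times_conv_shift mult.commute)
      finally show ?thesis .
    qed simp
    finally show "mps_coeff (mps_sum ?t {1..}) m =
      fls_shift (int (weight kp_weight m)) (fls_const (mps_coeff (?B $ weight kp_weight m) m))" .
  qed
  from graded_at_z_exp[OF this _ kp_weight_pos] show ?thesis
    by (simp add: kp_exponential_def complete_series_def exp_series_def)
qed

text \<open>The coefficient of \<open>z\<^sup>-\<^sup>1\<close> picks the power \<open>z\<^bsup>n-1\<^esup>\<close> from the exponential. For \<open>n = 0\<close> there is no such
  power, in accordance with \<open>complete_sym\<close> being zero at \<open>-1\<close>.\<close>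

lemma coeff_zinv_kp_exponential:
  fixes f :: "(nat + nat, 'k::comm_rat_algebra) mps"
  shows "coeff_zinv (kp_exponential * (kp_zinv ^ n * zconst f)) =
     complete_sym (\<lambda>j. xvar j - xvar' j) (int n - 1) * f"
proof (rule mps_eqI)
  fix m
  let ?H = "complete_series (\<lambda>j. xvar j - xvar' j)"
  note graded = graded_at_z_kp_exponential[where 'k = 'k, unfolded graded_at_z_def]
  have "mps_coeff (coeff_zinv (kp_exponential * (kp_zinv ^ n * zconst f))) m =
      (\<Sum>(a, b)\<in>splits m. fls_nth (mps_coeff kp_exponential a * (fls_X ^ n * fls_const (mps_coeff f b))) 1)"
    unfolding mps_const_power
    by (simp add: coeff_zinv_def mps_coeff_mult[of kp_exponential] fls_nth_sum case_prod_beta)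
  also have "\<dots> = (\<Sum>(a, b)\<in>splits m.
      mps_coeff (complete_sym (\<lambda>j. xvar j - xvar' j) (int n - 1)) a * mps_coeff f b)"
  proof (rule sum.cong[OF refl], clarify)
    fix a b
    assume "(a, b) \<in> splits m"
    have "fls_nth (mps_coeff kp_exponential a * (fls_X ^ n * fls_const (mps_coeff f b))) 1 =
        (if n = Suc (weight kp_weight a) then mps_coeff (?H $ weight kp_weight a) a * mps_coeff f b else 0)"
      using graded by (auto simp: fls_X_power_times_conv_shift fls_times_both_shifted_simp)
    also have "\<dots> = mps_coeff (complete_sym (\<lambda>j. xvar j - xvar' j) (int n - 1)) a * mps_coeff f b"
      using graded by (cases n) (auto simp: complete_sym_def)
    finally show "fls_nth (mps_coeff kp_exponential a * (fls_X ^ n * fls_const (mps_coeff f b))) 1 =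
        mps_coeff (complete_sym (\<lambda>j. xvar j - xvar' j) (int n - 1)) a * mps_coeff f b" .
  qed
  also have "\<dots> = mps_coeff (complete_sym (\<lambda>j. xvar j - xvar' j) (int n - 1) * f) m"
    by (simp add: mps_coeff_mult)
  finally show "mps_coeff (coeff_zinv (kp_exponential * (kp_zinv ^ n * zconst f))) m =
     mps_coeff (complete_sym (\<lambda>j. xvar j - xvar' j) (int n - 1) * f) m" .
qed

lemma coeff_zinv_sum: "coeff_zinv (sum f A) = (\<Sum>i\<in>A. coeff_zinv (f i))"
  by (rule mps_eqI) (simp add: coeff_zinv_def mps_coeff_sum fls_nth_sum)

definition pcoord :: "nat \<Rightarrow> (nat, 'k::comm_ring_1) mpoly" where
  "pcoord j = Poly_Mapping.single (Poly_Mapping.single (j - 1) 1) 1"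

abbreviation pconst :: "'k::comm_ring_1 \<Rightarrow> (nat, 'k) mpoly" where
  "pconst c \<equiv> Poly_Mapping.single 0 c"

text \<open>The entry \<open>(j, k)\<close> of the product of \<open>A\<close> with the matrix of complete symmetric functions. The
  parameter \<open>h\<close> embeds the coefficients into the ring of the \<open>p\<^sub>i\<close>.\<close>

abbreviation row_series ::
  "('b::comm_rat_algebra \<Rightarrow> 'a::comm_rat_algebra) \<Rightarrow> int set \<Rightarrow> (int \<Rightarrow> nat \<Rightarrow> 'b) \<Rightarrow>
     (nat \<Rightarrow> 'a) \<Rightarrow> nat \<Rightarrow> int \<Rightarrow> 'a" where
  "row_series h I A p j k \<equiv> \<Sum>l\<in>I. h (A l j) * complete_sym p (l + k)"

lemma row_series_hom:
  fixes h :: "'a::comm_rat_algebra \<Rightarrow> 'c::comm_rat_algebra"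
  assumes "comm_ring_hom h"
  shows "h (row_series f I A p j k) = row_series (\<lambda>c. h (f c)) I A (\<lambda>k. h (p k)) j k"
proof -
  interpret comm_ring_hom h by fact
  show ?thesis
    by (simp add: hom_sum hom_mult complete_sym_hom[OF assms])
qed

lemma row_series_diff:
  assumes "\<And>n. complete_sym q n = complete_sym p n - w * complete_sym p (n - 1)"
  shows "row_series f I A q j k = row_series f I A p j k - w * row_series f I A p j (k - 1)"
proof -
  have "f (A l j) * complete_sym q (l + k) = f (A l j) * complete_sym p (l + k) -
      w * (f (A l j) * complete_sym p (l + (k - 1)))" for l
    unfolding assms[of "l + k"] by (simp add: algebra_simps)
  then show ?thesis
    by (simp add: sum_subtractf sum_distrib_left)
qed

lemma shift_subst_pcoord:
  assumes "j \<ge> 1"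
  shows "mps_subst (\<lambda>v. kp_p (v + 1) - kp_zinv ^ (v + 1)) (mps_of_mpoly (pcoord j)) = kp_p j - kp_zinv ^ j"
    "mps_subst (\<lambda>v. kp_p' (v + 1) + kp_zinv ^ (v + 1)) (mps_of_mpoly (pcoord j)) = kp_p' j + kp_zinv ^ j"
  using assms by (cases j; simp add: pcoord_def mps_subst_of_mpoly_single)+

lemma mps_subst_pconst: "mps_subst g (mps_of_mpoly (pconst c)) = mps_const (fls_const c)"
  by (simp add: mps_subst_of_mpoly_single)

text \<open>The hypothesis on \<open>R\<close> bounds the number of powers of \<open>z\<^sup>-\<^sup>1\<close> that occur: \<open>h\<^bsub>l-r\<^esub>\<close> vanishes for
  \<open>r > R\<close>.\<close>

lemma coeff_zinv_kp_determinant: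
  fixes A :: "int \<Rightarrow> nat \<Rightarrow> 'k::comm_rat_algebra"
  assumes "N > 0" and I: "\<And>l. l \<in> I \<Longrightarrow> l \<le> int R"
  defines "T \<equiv> det (mat N N (\<lambda>(j, k). row_series pconst I A pcoord j (int k)))"
  shows "coeff_zinv (kp_exponential *
      mps_subst (\<lambda>v. kp_p (v + 1) - kp_zinv ^ (v + 1)) (mps_of_mpoly T) *
      mps_subst (\<lambda>v. kp_p' (v + 1) + kp_zinv ^ (v + 1)) (mps_of_mpoly T)) = 0"
proof -
  let ?w = "kp_zinv :: 'k kp_ring"
  let ?\<phi> = "\<lambda>P. mps_subst (\<lambda>v. kp_p (v + 1) - kp_zinv ^ (v + 1)) (mps_of_mpoly P) :: 'k kp_ring"
  let ?\<psi> = "\<lambda>P. mps_subst (\<lambda>v. kp_p' (v + 1) + kp_zinv ^ (v + 1)) (mps_of_mpoly P) :: 'k kp_ring"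
  let ?C = "\<lambda>c. mps_const (fls_const c) :: 'k kp_ring"
  define u where "u = row_series (mps_const :: 'k \<Rightarrow> (nat + nat, 'k) mps) I A xvar"
  define v where "v = row_series (mps_const :: 'k \<Rightarrow> (nat + nat, 'k) mps) I A xvar'"
  \<comment> \<open>\<open>g j k\<close> is \<open>\<Sum>r. w\<^sup>r * v j (k - r)\<close>, the entry of the second shifted determinant.\<close>
  define g where "g = row_series ?C I A (\<lambda>i. kp_p' i + ?w ^ i)"
  define c where "c = complete_sym (\<lambda>i. xvar i - xvar' i :: (nat + nat, 'k) mps)"
  interpret z: comm_ring_hom "zconst :: (nat + nat, 'k) mps \<Rightarrow> 'k kp_ring"
    by (rule comm_ring_hom_mps_map[OF comm_ring_hom_fls_const])
  have zconst_const: "zconst (mps_const a) = ?C a" for a :: 'k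
    by (rule mps_eqI) (simp add: mps_coeff_const)
  have zu: "zconst (u j k) = row_series ?C I A kp_p j k"
    and zv: "zconst (v j k) = row_series ?C I A kp_p' j k" for j k
    by (simp_all add: u_def v_def row_series_hom[OF z.comm_ring_hom_axioms] zconst_const zconst_xvar)
  have minor_hom: "shift_minor N (\<lambda>j k. zconst (u j k)) s = zconst (shift_minor N u s)" for s
    by (simp add: shift_minor_def hom_det_mat[OF z.comm_ring_hom_axioms] z.hom_mult z.hom_power
        z.hom_uminus case_prod_unfold)
  have cofactor_hom: "column_cofactor N (\<lambda>j k. zconst (v j k)) j = zconst (column_cofactor N v j)" for j
    by (simp add: column_cofactor_def hom_det_mat[OF z.comm_ring_hom_axioms] z.hom_mult z.hom_power
        z.hom_uminus case_prod_unfold)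
  have \<phi>: "?\<phi> T = (\<Sum>s\<le>N. ?w ^ s * zconst (shift_minor N u s))"
  proof -
    have "?\<phi> (row_series pconst I A pcoord j k) = zconst (u j k) - ?w * zconst (u j (k - 1))" for j k
    proof -
      have "?\<phi> (row_series pconst I A pcoord j k) = row_series ?C I A (\<lambda>i. ?\<phi> (pcoord i)) j k"
        by (simp only: row_series_hom[OF comm_ring_hom_mps_subst] mps_subst_pconst)
      also have "\<dots> = row_series ?C I A (\<lambda>i. kp_p i - ?w ^ i) j k"
        by (intro sum.cong[OF refl] arg_cong2[of _ _ _ _ "(*)"] complete_sym_cong shift_subst_pcoord refl)
      also have "\<dots> = zconst (u j k) - ?w * zconst (u j (k - 1))"
        unfolding zu by (rule row_series_diff) (rule complete_sym_diff_power)
      finally show ?thesis .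
    qed
    then have "?\<phi> T = det (mat N N (\<lambda>(j, k). zconst (u j (int k)) - ?w * zconst (u j (int k - 1))))"
      unfolding T_def hom_det_mat[OF comm_ring_hom_mps_subst] by (simp add: case_prod_unfold)
    also have "\<dots> = (\<Sum>s\<le>N. ?w ^ s * zconst (shift_minor N u s))"
      unfolding minor_hom[symmetric] by (rule det_shifted_columns)
    finally show ?thesis .
  qed
  have \<psi>: "?\<psi> T = (\<Sum>r\<le>R. ?w ^ r * zconst (\<Sum>j<N. v j (- int r) * column_cofactor N v j))"
  proof -
    have "?\<psi> (row_series pconst I A pcoord j k) = g j k" for j k
    proof -
      have "?\<psi> (row_series pconst I A pcoord j k) = row_series ?C I A (\<lambda>i. ?\<psi> (pcoord i)) j k"
        by (simp only: row_series_hom[OF comm_ring_hom_mps_subst] mps_subst_pconst)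
      also have "\<dots> = g j k"
        unfolding g_def
        by (intro sum.cong[OF refl] arg_cong2[of _ _ _ _ "(*)"] complete_sym_cong shift_subst_pcoord refl)
      finally show ?thesis .
    qed
    then have "?\<psi> T = det (mat N N (\<lambda>(j, k). g j (int k)))"
      unfolding T_def hom_det_mat[OF comm_ring_hom_mps_subst] by (simp add: case_prod_unfold)
    also have "\<dots> = (\<Sum>j<N. g j 0 * column_cofactor N (\<lambda>j k. zconst (v j k)) j)"
    proof (rule det_geometric_columns[OF assms(1)])
      fix j k
      show "zconst (v j k) = g j k - ?w * g j (k - 1)"
        unfolding zv g_def
      proof (rule row_series_diff)
        fix n
        show "complete_sym kp_p' n = complete_sym (\<lambda>i. kp_p' i + ?w ^ i) n -
            ?w * complete_sym (\<lambda>i. kp_p' i + ?w ^ i) (n - 1)"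
          using complete_sym_diff_power[of "\<lambda>i. kp_p' i + ?w ^ i" ?w n] by simp
      qed
    qed
    also have "\<dots> = (\<Sum>j<N. (\<Sum>r\<le>R. ?w ^ r * zconst (v j (- int r))) * zconst (column_cofactor N v j))"
    proof -
      have "g j 0 = (\<Sum>r\<le>R. ?w ^ r * zconst (v j (- int r)))" for j
      proof -
        have "g j 0 = (\<Sum>l\<in>I. \<Sum>r\<le>R. ?C (A l j) * (?w ^ r * complete_sym kp_p' (l - int r)))"
          unfolding g_def by (rule sum.cong) (auto simp: complete_sym_add_power[OF I] sum_distrib_left)
        also have "\<dots> = (\<Sum>r\<le>R. ?w ^ r * zconst (v j (- int r)))"
          unfolding zv sum_distrib_left by (subst sum.swap) (simp add: mult_ac)
        finally show ?thesis .
      qed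
      then show ?thesis
        by (simp add: cofactor_hom)
    qed
    also have "\<dots> = (\<Sum>r\<le>R. ?w ^ r * zconst (\<Sum>j<N. v j (- int r) * column_cofactor N v j))"
      unfolding sum_distrib_right z.hom_sum z.hom_mult sum_distrib_left
      by (subst sum.swap) (simp add: mult.assoc)
    finally show ?thesis .
  qed
  let ?m = "\<lambda>s. shift_minor N u s" and ?e = "\<lambda>r. \<Sum>j<N. v j (- int r) * column_cofactor N v j"
  have "kp_exponential * ?\<phi> T * ?\<psi> T =
      kp_exponential * (\<Sum>s\<le>N. \<Sum>r\<le>R. (?w ^ s * zconst (?m s)) * (?w ^ r * zconst (?e r)))"
    by (simp only: \<phi> \<psi> mult.assoc[of kp_exponential] sum_product)
  also have "\<dots> = (\<Sum>s\<le>N. \<Sum>r\<le>R. kp_exponential * ((?w ^ s * zconst (?m s)) * (?w ^ r * zconst (?e r))))"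
    by (simp only: sum_distrib_left[of kp_exponential])
  also have "\<dots> = (\<Sum>s\<le>N. \<Sum>r\<le>R. kp_exponential * (?w ^ (s + r) * zconst (?m s * ?e r)))"
    by (simp only: z.hom_mult power_add mult_ac)
  finally have "coeff_zinv (kp_exponential * ?\<phi> T * ?\<psi> T) =
      (\<Sum>s\<le>N. \<Sum>r\<le>R. coeff_zinv (kp_exponential * (?w ^ (s + r) * zconst (?m s * ?e r))))"
    by (simp only: coeff_zinv_sum)
  also have "\<dots> = (\<Sum>s\<le>N. \<Sum>r\<le>R. c (int (s + r) - 1) *
        (shift_minor N u s * (\<Sum>j<N. v j (- int r) * column_cofactor N v j)))"
    by (simp only: coeff_zinv_kp_exponential c_def)
  also have "\<dots> = 0"
  proof (rule determinantal_bilinear_identity)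
    fix j k
    show "v j k = 0" if "k < - int R"
      unfolding v_def by (rule sum.neutral) (use that I in force)
    assume "- 1 \<le> k" "k < int N"
    then have bound: "l + k \<le> int (N + R)" if "l \<in> I" for l
      using I[OF that] by simp
    have "u j k = (\<Sum>l\<in>I. \<Sum>i\<le>N + R. mps_const (A l j) * (c (int i) * complete_sym xvar' (l + k - int i)))"
      unfolding u_def
    proof (rule sum.cong[OF refl])
      fix l
      assume "l \<in> I"
      have "complete_sym xvar (l + k) = (\<Sum>i\<le>N + R. c (int i) * complete_sym xvar' (l + k - int i))"
        using complete_sym_add[OF bound[OF \<open>l \<in> I\<close>], of "\<lambda>i. xvar i - xvar' i" xvar'] by (simp add: c_def)
      then show "mps_const (A l j) * complete_sym xvar (l + k) =
          (\<Sum>i\<le>N + R. mps_const (A l j) * (c (int i) * complete_sym xvar' (l + k - int i)))"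
        by (simp add: sum_distrib_left)
    qed
    also have "\<dots> = (\<Sum>i\<le>N + R. c (int i) * v j (k - int i))"
      unfolding v_def sum_distrib_left by (subst sum.swap) (simp add: mult_ac algebra_simps)
    finally show "u j k = (\<Sum>i\<le>N + R. c (int i) * v j (k - int i))" .
  qed (simp add: c_def)
  finally show ?thesis .
qed

lemma fls_homogeneous_kp_shifts:
  "fls_homogeneous kp_weight (Suc v) (kp_p (v + 1) - kp_zinv ^ (v + 1))"
  "fls_homogeneous kp_weight (Suc v) (kp_p' (v + 1) + kp_zinv ^ (v + 1))"
proof -
  have "Poly_Mapping.single x (Suc 0) \<noteq> 0" for x :: "nat + nat"
    by (metis lookup_single_eq lookup_zero nat.distinct(1))
  then show "fls_homogeneous kp_weight (Suc v) (kp_p (v + 1) - kp_zinv ^ (v + 1))"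
    "fls_homogeneous kp_weight (Suc v) (kp_p' (v + 1) + kp_zinv ^ (v + 1))"
    unfolding fls_homogeneous_def mps_const_power kp_p_def kp_p'_def
    by (auto simp: mps_coeff_var mps_coeff_const simp del: power_Suc split: if_splits)
qed

lemma kp_bilinear_eq: "kp_bilinear \<tau> = kp_exponential *
    mps_subst (\<lambda>v. kp_p (v + 1) - kp_zinv ^ (v + 1)) \<tau> *
    mps_subst (\<lambda>v. kp_p' (v + 1) + kp_zinv ^ (v + 1)) \<tau>"
  unfolding kp_bilinear_def kp_exponential_def ..

text \<open>All three factors of the bilinear expression have only terms of nonnegative weight, and the
  exponential does not depend on \<open>\<tau>\<close>.\<close>

lemma kp_bilinear_cong:
  fixes \<tau> \<tau>' :: "(nat, 'k::comm_rat_algebra) mps"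
  assumes "\<And>\<alpha>. int (weight Suc \<alpha>) \<le> W \<Longrightarrow> mps_coeff \<tau> \<alpha> = mps_coeff \<tau>' \<alpha>"
  shows "fls_agree kp_weight W (kp_bilinear \<tau>) (kp_bilinear \<tau>')"
proof -
  let ?g = "\<lambda>v. kp_p (v + 1) - kp_zinv ^ (v + 1) :: 'k kp_ring"
  let ?h = "\<lambda>v. kp_p' (v + 1) + kp_zinv ^ (v + 1) :: 'k kp_ring"
  have agree: "fls_agree kp_weight W (mps_subst g \<tau>) (mps_subst g \<tau>')"
    and neg: "fls_agree kp_weight (- 1) (mps_subst g \<sigma>) 0"
    if "\<And>v. fls_homogeneous kp_weight (Suc v) (g v)" for g :: "nat \<Rightarrow> 'k kp_ring" and \<sigma>
    unfolding fls_agree_def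
    by (auto intro!: mps_subst_nth_cong[OF that] mps_subst_nth_neg[OF that] assms)
  have e: "fls_agree kp_weight (- 1) (kp_exponential :: 'k kp_ring) 0"
    using graded_at_z_kp_exponential[where 'k = 'k] by (auto simp: graded_at_z_def fls_agree_def)
  have z: "fls_agree kp_weight (- 1) (0 :: 'k kp_ring) 0" and r: "fls_agree kp_weight W f f" for f :: "'k kp_ring"
    by (auto simp: fls_agree_def)
  note g = fls_homogeneous_kp_shifts(1) and h = fls_homogeneous_kp_shifts(2)
  \<comment> \<open>The partial product of the first two factors again has only terms of nonnegative weight.\<close>
  have neg2: "fls_agree kp_weight (- 1) (kp_exponential * mps_subst ?g \<sigma>) 0" for \<sigma>
    using fls_agree_mult[OF e neg[OF g, of \<sigma>] e z neg[OF g, of \<sigma>] z] by simp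
  show ?thesis
    unfolding kp_bilinear_eq
    by (intro fls_agree_mult r agree neg neg2 e g h)
qed

text \<open>The coefficient of \<open>z\<^sup>-\<^sup>1\<close> at the monomial \<open>m\<close> has total weight one more than \<open>m\<close>, so only the
  coefficients of \<open>\<tau>\<close> up to that weight enter.\<close>

lemma kp_bilinear_eq_0_of_determinants:
  fixes \<tau> :: "(nat, 'k::comm_rat_algebra) mps" and A :: "int \<Rightarrow> nat \<Rightarrow> 'k"
  assumes "\<And>W. \<exists>N>0. \<exists>I R. (\<forall>l\<in>I. l \<le> int R) \<and> (\<forall>\<alpha>. weight Suc \<alpha> \<le> W \<longrightarrow> mps_coeff \<tau> \<alpha> =
     mps_coeff (mps_of_mpoly (det (mat N N (\<lambda>(j, k). row_series pconst I A pcoord j (int k))))) \<alpha>)"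
  shows "coeff_zinv (kp_bilinear \<tau>) = 0"
proof (rule mps_eqI)
  fix m
  obtain N I R where N: "N > 0" and R: "\<And>l. l \<in> I \<Longrightarrow> l \<le> int R"
    and eq: "\<And>\<alpha>. weight Suc \<alpha> \<le> Suc (weight kp_weight m) \<Longrightarrow> mps_coeff \<tau> \<alpha> =
      mps_coeff (mps_of_mpoly (det (mat N N (\<lambda>(j, k). row_series pconst I A pcoord j (int k))))) \<alpha>"
    using assms[of "Suc (weight kp_weight m)"] by blast
  let ?T = "det (mat N N (\<lambda>(j, k). row_series pconst I A pcoord j (int k)))"
  have "fls_agree kp_weight (int (Suc (weight kp_weight m))) (kp_bilinear \<tau>) (kp_bilinear (mps_of_mpoly ?T))"
    by (rule kp_bilinear_cong) (use eq in auto)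
  then have "mps_coeff (coeff_zinv (kp_bilinear \<tau>)) m =
      mps_coeff (coeff_zinv (kp_bilinear (mps_of_mpoly ?T))) m"
    by (simp add: fls_agree_def coeff_zinv_def)
  also have "coeff_zinv (kp_bilinear (mps_of_mpoly ?T)) = 0"
    unfolding kp_bilinear_eq by (rule coeff_zinv_kp_determinant[OF N R])
  finally show "mps_coeff (coeff_zinv (kp_bilinear \<tau>)) m = mps_coeff 0 m" .
qed

section \<open>From determinants to sums over partitions\<close>

text \<open>The additional rows have a single \<open>1\<close> on the diagonal and zeros to the left of it. This is why the
  minor attached to a partition does not change when zero parts are appended.\<close>

lemma det_padding:
  fixes X :: "int \<Rightarrow> nat \<Rightarrow> 'a::comm_ring_1"
  assumes "\<And>m j. m < - int j \<Longrightarrow> X m j = 0" "\<And>j. X (- int j) j = 1"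
    and f: "\<And>i. L \<le> i \<Longrightarrow> f i = - int i" and "L \<le> N"
  shows "det (mat N N (\<lambda>(i, j). X (f i) j)) = det (mat L L (\<lambda>(i, j). X (f i) j))"
  using \<open>L \<le> N\<close>
proof (induction N rule: dec_induct)
  case (step N)
  let ?B = "mat (Suc N) (Suc N) (\<lambda>(i, j). X (f i) j)"
  have "det ?B = (\<Sum>j<Suc N. ?B $$ (N, j) * cofactor ?B N j)"
    by (rule laplace_expansion_row[OF mat_carrier]) simp
  also have "\<dots> = (\<Sum>j<Suc N. if j = N then cofactor ?B N N else 0)"
    using step.hyps by (intro sum.cong) (auto simp: f assms(1,2))
  also have "\<dots> = det (mat_delete ?B N N)"
    by (simp add: cofactor_def flip: mult_2)
  also have "mat_delete ?B N N = mat N N (\<lambda>(i, j). X (f i) j)"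
    by (rule eq_matI) (auto simp: mat_delete_def)
  finally show ?case
    using step.IH by simp
qed simp

definition part :: "nat list \<Rightarrow> nat \<Rightarrow> nat" where
  "part \<mu> i = (if i < length \<mu> then \<mu> ! i else 0)"

definition box_partitions :: "nat \<Rightarrow> nat \<Rightarrow> nat list set" where
  "box_partitions N M = {\<mu>. is_partition \<mu> \<and> length \<mu> \<le> N \<and> (\<forall>k\<in>set \<mu>. k \<le> M)}"

definition shifted_parts :: "nat \<Rightarrow> nat list \<Rightarrow> int list" where
  "shifted_parts N \<mu> = map (\<lambda>i. int (part \<mu> i) - int i) [0..<N]"

lemma part_antimono: "is_partition \<mu> \<Longrightarrow> i \<le> j \<Longrightarrow> part \<mu> j \<le> part \<mu> i"
  by (cases "i = j") (auto simp: part_def is_partition_def sorted_wrt_iff_nth_less)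

lemma part_pos_iff: "is_partition \<mu> \<Longrightarrow> part \<mu> i > 0 \<longleftrightarrow> i < length \<mu>"
  by (auto simp: part_def is_partition_def Suc_le_eq dest: bspec[of _ _ "\<mu> ! i"])

lemma finite_box_partitions: "finite (box_partitions N M)"
  by (rule finite_subset[OF _ finite_lists_length_le[of "{..M}" N]]) (auto simp: box_partitions_def)

text \<open>For the inverse, add \<open>i\<close> to the entry \<open>i\<close> of a decreasing list. The result is weakly decreasing and
  nonnegative, and cutting it off at the first zero gives the partition.\<close>

lemma bij_betw_shifted_parts:
  "bij_betw (shifted_parts N) (box_partitions N M) (decreasing_lists N {1 - int N..int M})"
  unfolding bij_betw_def
proof (intro conjI equalityI subsetI)
  show "inj_on (shifted_parts N) (box_partitions N M)"
  proof (rule inj_onI)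
    fix \<mu> \<nu>
    assume \<mu>: "\<mu> \<in> box_partitions N M" and \<nu>: "\<nu> \<in> box_partitions N M"
      and eq: "shifted_parts N \<mu> = shifted_parts N \<nu>"
    have part: "part \<mu> i = part \<nu> i" for i
    proof (cases "i < N")
      case True
      then show ?thesis
        using arg_cong[OF eq, of "\<lambda>s. s ! i"] by (simp add: shifted_parts_def)
    qed (use \<mu> \<nu> in \<open>auto simp: part_def box_partitions_def\<close>)
    then have "i < length \<mu> \<longleftrightarrow> i < length \<nu>" for i
      using \<mu> \<nu> part_pos_iff[of \<mu> i] part_pos_iff[of \<nu> i] by (auto simp: box_partitions_def)
    then have len: "length \<mu> = length \<nu>"
      by (metis less_irrefl linorder_neqE_nat)
    show "\<mu> = \<nu>"
      by (rule nth_equalityI[OF len]) (use part len in \<open>metis part_def\<close>)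
  qed
next
  fix s
  assume "s \<in> shifted_parts N ` box_partitions N M"
  then obtain \<mu> where \<mu>: "\<mu> \<in> box_partitions N M" and s: "s = shifted_parts N \<mu>"
    by blast
  have "part \<mu> i \<le> M" for i
    using \<mu> by (auto simp: part_def box_partitions_def)
  then have "int (part \<mu> i) \<le> int M" for i
    by simp
  then have "int (part \<mu> i) - int i \<le> int M" for i
    by (smt (verit) of_nat_0_le_iff)
  moreover have "sorted_wrt (>) s"
    using part_antimono[of \<mu>] \<mu>
    by (auto simp: s shifted_parts_def sorted_wrt_iff_nth_less box_partitions_def)
       (smt (verit) less_imp_le of_nat_less_iff of_nat_le_iff)
  ultimately show "s \<in> decreasing_lists N {1 - int N..int M}"
    by (auto simp: decreasing_lists_def s shifted_parts_def)
next
  fix s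
  assume s: "s \<in> decreasing_lists N {1 - int N..int M}"
  then have len: "length s = N" and dec: "\<And>i j. i < j \<Longrightarrow> j < N \<Longrightarrow> s ! j < s ! i"
    and range: "\<And>i. i < N \<Longrightarrow> 1 - int N \<le> s ! i \<and> s ! i \<le> int M"
    by (auto simp: decreasing_lists_def sorted_wrt_iff_nth_less dest!: nth_mem)
  have antimono: "s ! j + int j \<le> s ! i + int i" if "i \<le> j" "j < N" for i j
    using that
  proof (induction j rule: dec_induct)
    case (step j)
    then show ?case
      using dec[of j "Suc j"] by simp
  qed simp
  have nonneg: "0 \<le> s ! i + int i" if "i < N" for i
    using antimono[of i "N - 1"] range[of "N - 1"] that by (cases N) auto
  define q where "q i = nat (s ! i + int i)" for i
  have q: "int (q i) = s ! i + int i" if "i < N" for i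
    using nonneg[OF that] by (simp add: q_def)
  have q_antimono: "q j \<le> q i" if "i \<le> j" "j < N" for i j
    using antimono[OF that] by (simp add: q_def)
  have q_le: "q i \<le> M" if "i < N" for i
    using antimono[of 0 i] range[of 0] that by (simp add: q_def nat_le_iff)
  define \<mu> where "\<mu> = takeWhile (\<lambda>k. k > 0) (map q [0..<N])"
  have length_le: "length \<mu> \<le> N"
    using length_takeWhile_le[of "\<lambda>k. k > 0" "map q [0..<N]"] by (simp add: \<mu>_def)
  have nth: "\<mu> ! i = q i" if "i < length \<mu>" for i
    using that length_le takeWhile_nth[of i "\<lambda>k. k > 0" "map q [0..<N]"] by (simp add: \<mu>_def)
  have part: "part \<mu> i = q i" if "i < N" for i
  proof (cases "i < length \<mu>")
    case False
    then have "\<not> 0 < map q [0..<N] ! length \<mu>"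
      using that unfolding \<mu>_def by (intro nth_length_takeWhile) simp
    then have "q (length \<mu>) = 0"
      using False that by simp
    then show ?thesis
      using q_antimono[of "length \<mu>" i] False that by (simp add: part_def)
  qed (simp add: part_def nth)
  have "is_partition \<mu>"
    using q_antimono length_le
    by (auto simp: is_partition_def sorted_wrt_iff_nth_less nth) (auto simp: \<mu>_def Suc_le_eq dest: set_takeWhileD)
  moreover have "\<forall>k\<in>set \<mu>. k \<le> M"
    using q_le by (auto simp: \<mu>_def dest!: set_takeWhileD)
  ultimately have "\<mu> \<in> box_partitions N M"
    using length_le by (simp add: box_partitions_def)
  moreover have "shifted_parts N \<mu> = s"
    by (rule nth_equalityI) (auto simp: shifted_parts_def len part q)
  ultimately show "s \<in> shifted_parts N ` box_partitions N M"
    by blast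
qed

text \<open>The Pluecker coordinate at \<open>\<mu>\<close> of the column space of \<open>A\<close>, provided \<open>A\<close> is unitriangular, so that
  a minor of this size represents all larger ones.\<close>

definition pluecker :: "(int \<Rightarrow> nat \<Rightarrow> 'a::comm_ring_1) \<Rightarrow> nat list \<Rightarrow> 'a" where
  "pluecker A \<mu> = det (mat (length \<mu>) (length \<mu>) (\<lambda>(i, j). A (int (\<mu> ! i) - int i) j))"

lemma det_shifted_parts:
  assumes "\<And>m j. m < - int j \<Longrightarrow> A m j = 0" "\<And>j. A (- int j) j = 1" "length \<mu> \<le> N"
  shows "det (mat N N (\<lambda>(i, j). A (shifted_parts N \<mu> ! i) j)) = pluecker A \<mu>"
proof -
  have "det (mat N N (\<lambda>(i, j). A (shifted_parts N \<mu> ! i) j)) =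
      det (mat N N (\<lambda>(i, j). A (int (part \<mu> i) - int i) j))"
    by (rule det_mat_cong) (simp add: shifted_parts_def)
  also have "\<dots> = det (mat (length \<mu>) (length \<mu>) (\<lambda>(i, j). A (int (part \<mu> i) - int i) j))"
    by (rule det_padding) (use assms in \<open>auto simp: part_def\<close>)
  also have "\<dots> = pluecker A \<mu>"
    unfolding pluecker_def by (rule det_mat_cong) (simp add: part_def)
  finally show ?thesis .
qed

lemma schur_eq_pluecker: "schur \<mu> p = pluecker (\<lambda>m j. complete_sym p (m + int j)) \<mu>"
  by (simp add: schur_def pluecker_def)

text \<open>This is the Cauchy--Binet formula. The indices \<open>l = \<mu>\<^sub>i - i\<close> with \<open>i < N\<close> run through the decreasing
  lists in \<open>{1 - N..M}\<close> when \<open>\<mu>\<close> runs through the partitions with at most \<open>N\<close> parts, all at most \<open>M\<close>.\<close>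

lemma mps_of_mpoly_det_row_series:
  fixes A :: "int \<Rightarrow> nat \<Rightarrow> 'k::comm_rat_algebra" and N M :: nat
  assumes "\<And>m j. m < - int j \<Longrightarrow> A m j = 0" "\<And>j. A (- int j) j = 1"
  defines "I \<equiv> {1 - int N..int M}"
  shows "mps_of_mpoly (det (mat N N (\<lambda>(j, k). row_series pconst I A pcoord j (int k)))) =
     (\<Sum>\<mu>\<in>box_partitions N M. mps_const (pluecker A \<mu>) * schur \<mu> pvar)"
proof -
  interpret c: comm_ring_hom "mps_const :: 'k \<Rightarrow> (nat, 'k) mps"
    by (rule comm_ring_hom_mps_const)
  let ?h = "\<lambda>l k. complete_sym pvar (l + int k) :: (nat, 'k) mps"
  have "mps_of_mpoly (pconst a) = mps_const a" for a :: 'k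
    by (rule mps_eqI) (auto simp: mps_coeff_const lookup_single when_def)
  moreover have "mps_of_mpoly (pcoord j) = (pvar j :: (nat, 'k) mps)" for j
    by (rule mps_eqI) (auto simp: pvar_def pcoord_def mps_coeff_var lookup_single when_def)
  ultimately have row: "mps_of_mpoly (row_series pconst I A pcoord j k) = row_series mps_const I A pvar j k" for j k
    by (simp only: row_series_hom[OF comm_ring_hom_mps_of_mpoly])
  have "mps_of_mpoly (det (mat N N (\<lambda>(j, k). row_series pconst I A pcoord j (int k)))) =
      det (mat N N (\<lambda>(j, k). \<Sum>l\<in>I. mps_const (A l j) * ?h l k))"
    unfolding hom_det_mat[OF comm_ring_hom_mps_of_mpoly] by (rule det_mat_cong) (simp add: row)
  also have "\<dots> = (\<Sum>s\<in>decreasing_lists N I. det (mat N N (\<lambda>(i, j). mps_const (A (s ! i) j))) *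
      det (mat N N (\<lambda>(i, k). ?h (s ! i) k)))"
    by (rule Cauchy_Binet) (simp add: I_def)
  also have "\<dots> = (\<Sum>\<mu>\<in>box_partitions N M.
      det (mat N N (\<lambda>(i, j). mps_const (A (shifted_parts N \<mu> ! i) j))) *
      det (mat N N (\<lambda>(i, k). ?h (shifted_parts N \<mu> ! i) k)))"
    unfolding I_def by (rule sum.reindex_bij_betw[OF bij_betw_shifted_parts, symmetric])
  also have "\<dots> = (\<Sum>\<mu>\<in>box_partitions N M. mps_const (pluecker A \<mu>) * schur \<mu> pvar)"
  proof (rule sum.cong[OF refl])
    fix \<mu>
    assume "\<mu> \<in> box_partitions N M"
    then have len: "length \<mu> \<le> N"
      by (simp add: box_partitions_def)
    have "pluecker A \<mu> = det (mat N N (\<lambda>(i, j). A (shifted_parts N \<mu> ! i) j))"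
      by (rule det_shifted_parts[symmetric]) (use assms len in auto)
    then have "det (mat N N (\<lambda>(i, j). mps_const (A (shifted_parts N \<mu> ! i) j))) =
        (mps_const (pluecker A \<mu>) :: (nat, 'k) mps)"
      by (simp only: hom_det_mat[OF c.comm_ring_hom_axioms] case_prod_unfold)
    moreover have "det (mat N N (\<lambda>(i, k). ?h (shifted_parts N \<mu> ! i) k)) = schur \<mu> pvar"
      unfolding schur_eq_pluecker by (rule det_shifted_parts[OF _ _ len]) auto
    ultimately show "det (mat N N (\<lambda>(i, j). mps_const (A (shifted_parts N \<mu> ! i) j))) *
        det (mat N N (\<lambda>(i, k). ?h (shifted_parts N \<mu> ! i) k)) = mps_const (pluecker A \<mu>) * schur \<mu> pvar"
      by simp
  qed
  finally show ?thesis .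
qed

definition mps_homogeneous :: "int \<Rightarrow> (nat, 'a::comm_ring_1) mps \<Rightarrow> bool" where
  "mps_homogeneous d f \<longleftrightarrow> (\<forall>\<alpha>. mps_coeff f \<alpha> \<noteq> 0 \<longrightarrow> int (weight Suc \<alpha>) = d)"

lemma mps_homogeneous_mult:
  assumes "mps_homogeneous d f" "mps_homogeneous e g"
  shows "mps_homogeneous (d + e) (f * g)"
  unfolding mps_homogeneous_def
proof (intro allI impI, rule ccontr)
  fix \<alpha>
  assume nz: "mps_coeff (f * g) \<alpha> \<noteq> 0" and neq: "int (weight Suc \<alpha>) \<noteq> d + e"
  have "mps_coeff (f * g) \<alpha> = 0"
  proof (rule mps_coeff_mult_eq_0)
    fix a b
    assume "(a, b) \<in> splits \<alpha>"
    from weight_splits[OF this, of Suc] show "mps_coeff f a = 0 \<or> mps_coeff g b = 0"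
      using assms neq by (auto simp: mps_homogeneous_def)
  qed
  with nz show False ..
qed

lemma mps_homogeneous_1: "mps_homogeneous 0 1"
  by (auto simp: mps_homogeneous_def mps_coeff_1)

lemma mps_homogeneous_sum:
  "(\<And>i. i \<in> A \<Longrightarrow> mps_homogeneous d (f i)) \<Longrightarrow> mps_homogeneous d (sum f A)"
  unfolding mps_homogeneous_def mps_coeff_sum by (meson sum.neutral)

lemma mps_homogeneous_prod:
  "(\<And>i. i \<in> A \<Longrightarrow> mps_homogeneous (d i) (f i)) \<Longrightarrow> mps_homogeneous (sum d A) (prod f A)"
  by (induction A rule: infinite_finite_induct) (auto simp: mps_homogeneous_1 intro: mps_homogeneous_mult)

lemma mps_homogeneous_complete_series:
  "mps_homogeneous (int n) (complete_series pvar $ n :: (nat, 'a::comm_rat_algebra) mps)"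
proof (induction n rule: less_induct)
  case (less n)
  show ?case
  proof (cases n)
    case (Suc m)
    let ?h = "complete_series pvar :: (nat, 'a) mps fps"
    \<comment> \<open>Newton's identity expresses \<open>n h\<^sub>n\<close> by the lower \<open>h\<^sub>k\<close>, and \<open>n\<close> can be cancelled.\<close>
    have "mps_homogeneous (int n) (\<Sum>j=0..m. pvar (Suc j) * ?h $ (m - j))"
    proof (rule mps_homogeneous_sum)
      fix j
      assume j: "j \<in> {0..m}"
      have "mps_homogeneous (int (Suc j) + int (m - j)) (pvar (Suc j) * ?h $ (m - j))"
        by (intro mps_homogeneous_mult less) (auto simp: Suc mps_homogeneous_def pvar_def mps_coeff_var)
      then show "mps_homogeneous (int n) (pvar (Suc j) * ?h $ (m - j))"
        using j by (simp add: Suc of_nat_diff)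
    qed
    also have "(\<Sum>j=0..m. pvar (Suc j) * ?h $ (m - j)) = of_nat n * ?h $ n"
      using arg_cong[OF fps_deriv_complete_series[of "pvar :: nat \<Rightarrow> (nat, 'a) mps"], of "\<lambda>f. f $ m"]
      by (simp add: fps_mult_nth Suc)
    finally have hom: "mps_homogeneous (int n) (of_nat n * ?h $ n)" .
    show ?thesis
      unfolding mps_homogeneous_def
    proof (intro allI impI, rule ccontr)
      fix \<alpha>
      assume nz: "mps_coeff (?h $ n) \<alpha> \<noteq> 0" and "int (weight Suc \<alpha>) \<noteq> int n"
      then have "of_nat n * mps_coeff (?h $ n) \<alpha> = of_nat n * 0"
        using hom unfolding of_nat_mps by (auto simp: mps_homogeneous_def)
      then have "mps_coeff (?h $ n) \<alpha> = 0"
        by (rule of_nat_mult_left_cancel[rotated]) (simp add: Suc)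
      with nz show False ..
    qed
  qed (simp add: mps_homogeneous_1)
qed

lemma mps_homogeneous_complete_sym:
  "mps_homogeneous n (complete_sym pvar n :: (nat, 'a::comm_rat_algebra) mps)"
  using mps_homogeneous_complete_series[of "nat n", where 'a = 'a]
  by (auto simp: complete_sym_def mps_homogeneous_def)

text \<open>Each term of the determinant has weight \<open>\<Sum>i. \<mu>\<^sub>i - i + \<pi>(i)\<close>, which is the size of \<open>\<mu>\<close>.\<close>

lemma mps_homogeneous_schur:
  "mps_homogeneous (int (sum_list \<mu>)) (schur \<mu> pvar :: (nat, 'a::comm_rat_algebra) mps)"
  unfolding schur_def det_def'[OF mat_carrier]
proof (rule mps_homogeneous_sum)
  let ?L = "length \<mu>"
  fix p
  assume "p \<in> {p. p permutes {0..<?L}}"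
  then have p: "p permutes {0..<?L}"
    by simp
  let ?f = "\<lambda>i. mat ?L ?L (\<lambda>(i, j). complete_sym pvar (int (\<mu> ! i) - int i + int j)) $$ (i, p i)
    :: (nat, 'a) mps"
  have "mps_homogeneous (\<Sum>i=0..<?L. int (\<mu> ! i) - int i + int (p i)) (\<Prod>i=0..<?L. ?f i)"
    by (rule mps_homogeneous_prod) (use permutes_in_image[OF p] in \<open>auto intro: mps_homogeneous_complete_sym\<close>)
  also have "(\<Sum>i=0..<?L. int (\<mu> ! i) - int i + int (p i)) = int (sum_list \<mu>)"
    using sum.permute[OF p, of int] by (simp add: sum.distrib sum_subtractf sum_list_sum_nth)
  finally have "mps_homogeneous (int (sum_list \<mu>)) (\<Prod>i=0..<?L. ?f i)" .
  then show "mps_homogeneous (int (sum_list \<mu>)) (signof p * (\<Prod>i=0..<?L. ?f i))"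
    by (cases p rule: sign_cases) (auto simp: mps_homogeneous_def)
qed

text \<open>Only partitions of one size contribute to a given monomial, and these lie in the box as soon as its
  sides are at least their size. The infinite sum over partitions is therefore locally finite.\<close>

lemma mps_coeff_schur_series:
  fixes a :: "nat list \<Rightarrow> 'a::comm_rat_algebra"
  assumes "weight Suc \<alpha> \<le> W"
  shows "mps_coeff (mps_sum (\<lambda>\<mu>. mps_const (a \<mu>) * schur \<mu> pvar) {\<mu>. is_partition \<mu>}) \<alpha> =
     mps_coeff (\<Sum>\<mu>\<in>box_partitions W W. mps_const (a \<mu>) * schur \<mu> pvar) \<alpha>"
  unfolding mps_coeff_sum
proof (rule mps_coeff_mps_sum[OF finite_box_partitions])
  fix \<mu>
  assume \<mu>: "\<mu> \<in> {\<mu>. is_partition \<mu>}" "\<mu> \<notin> box_partitions W W"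
  have "(\<forall>k\<in>set xs. 1 \<le> k) \<Longrightarrow> length xs \<le> sum_list xs" for xs :: "nat list"
    by (induction xs) auto
  then have "length \<mu> \<le> sum_list \<mu>"
    using \<mu> by (simp add: is_partition_def)
  moreover have "k \<le> sum_list \<mu>" if "k \<in> set \<mu>" for k
    using that by (auto intro: member_le_sum_list)
  ultimately have "\<mu> \<in> box_partitions W W" if "sum_list \<mu> \<le> W"
    using \<mu>(1) that by (force simp: box_partitions_def)
  then have "sum_list \<mu> \<noteq> weight Suc \<alpha>"
    using assms \<mu>(2) by auto
  then have "mps_coeff (schur \<mu> pvar :: (nat, 'a) mps) \<alpha> = 0"
    using mps_homogeneous_schur[of \<mu>, where 'a = 'a] by (auto simp: mps_homogeneous_def)
  then show "mps_coeff (mps_const (a \<mu>) * schur \<mu> pvar) \<alpha> = 0"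
    by simp
qed (auto simp: box_partitions_def)

text \<open>The triangular matrices \<open>A\<close> represent the points of the big cell of the Grassmannian, and each of
  these points gives a solution.\<close>

theorem kp_solution_log_pluecker_series:
  fixes A :: "int \<Rightarrow> nat \<Rightarrow> 'k::comm_rat_algebra"
  assumes A: "\<And>m j. m < - int j \<Longrightarrow> A m j = 0" "\<And>j. A (- int j) j = 1"
  shows "kp_solution (mps_log (mps_sum (\<lambda>\<mu>. mps_const (pluecker A \<mu>) * schur \<mu> pvar) {\<mu>. is_partition \<mu>}))"
proof -
  let ?\<tau> = "mps_sum (\<lambda>\<mu>. mps_const (pluecker A \<mu>) * schur \<mu> pvar) {\<mu>. is_partition \<mu>} :: (nat, 'k) mps"
  have box0: "box_partitions 0 0 = {[]}"
    by (auto simp: box_partitions_def is_partition_def)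
  have one: "mps_coeff ?\<tau> 0 = 1"
    by (subst mps_coeff_schur_series[of 0 0]) (simp_all add: box0 pluecker_def schur_def mps_coeff_1)
  have "coeff_zinv (kp_bilinear ?\<tau>) = 0"
  proof (rule kp_bilinear_eq_0_of_determinants)
    fix W
    \<comment> \<open>A box of side \<open>W\<close> would contain all relevant partitions; \<open>Suc W\<close> keeps the matrix nonempty.\<close>
    let ?N = "Suc W" and ?I = "{1 - int (Suc W)..int (Suc W)}"
    show "\<exists>N>0. \<exists>I R. (\<forall>l\<in>I. l \<le> int R) \<and> (\<forall>\<alpha>. weight Suc \<alpha> \<le> W \<longrightarrow> mps_coeff ?\<tau> \<alpha> =
        mps_coeff (mps_of_mpoly (det (mat N N (\<lambda>(j, k). row_series pconst I A pcoord j (int k))))) \<alpha>)"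
    proof (intro exI[of _ ?N] conjI exI[of _ ?I] exI[of _ "Suc W"] allI impI ballI)
      fix \<alpha>
      assume "weight Suc \<alpha> \<le> W"
      then show "mps_coeff ?\<tau> \<alpha> = mps_coeff (mps_of_mpoly
          (det (mat ?N ?N (\<lambda>(j, k). row_series pconst ?I A pcoord j (int k))))) \<alpha>"
        by (subst mps_of_mpoly_det_row_series) (use A in \<open>auto intro: mps_coeff_schur_series\<close>)
    qed auto
  qed
  then show ?thesis
    by (simp add: kp_solution_def mps_coeff_0_log[OF one] mps_exp_log[OF one])
qed

text \<open>The exponent of \<open>y\<^sub>c\<close> is the number of \<open>i\<close> with \<open>a(p(i)) \<le> c < b(i)\<close>. As each interval runs in
  the right direction, this is a difference of two cardinalities, and the one that involves \<open>p\<close> is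
  invariant under permutations. In a field one would telescope with quotients instead.\<close>

lemma prod_intervals_permute:
  fixes a b :: "nat \<Rightarrow> int" and y :: "int \<Rightarrow> 'a::comm_monoid_mult"
  assumes p: "p permutes {0..<n}" and ab: "\<And>i. i < n \<Longrightarrow> a i \<le> b i" "\<And>i. i < n \<Longrightarrow> a (p i) \<le> b i"
  shows "(\<Prod>i=0..<n. \<Prod>c\<in>{a (p i)..<b i}. y c) = (\<Prod>i=0..<n. \<Prod>c\<in>{a i..<b i}. y c)"
proof -
  \<comment> \<open>\<open>C\<close> is a finite set containing all the intervals, so that the products can be interchanged.\<close>
  define C where "C = (\<Union>i<n. {a i..<b i}) \<union> (\<Union>i<n. {a (p i)..<b i})"
  have expand: "(\<Prod>i=0..<n. \<Prod>c\<in>{f i..<b i}. y c) =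
      (\<Prod>c\<in>C. y c ^ (card {i. i < n \<and> f i \<le> c} - card {i. i < n \<and> b i \<le> c}))"
    if f: "\<And>i. i < n \<Longrightarrow> f i \<le> b i" "\<And>i. i < n \<Longrightarrow> {f i..<b i} \<subseteq> C" for f
  proof -
    have "(\<Prod>i=0..<n. \<Prod>c\<in>{f i..<b i}. y c) = (\<Prod>i=0..<n. \<Prod>c\<in>C. if c \<in> {f i..<b i} then y c else 1)"
    proof (rule prod.cong[OF refl])
      fix i
      assume "i \<in> {0..<n}"
      then have "{f i..<b i} = {c \<in> C. c \<in> {f i..<b i}}"
        using f(2)[of i] by auto
      then show "(\<Prod>c\<in>{f i..<b i}. y c) = (\<Prod>c\<in>C. if c \<in> {f i..<b i} then y c else 1)"
        by (subst prod.inter_filter[symmetric]) (auto simp: C_def)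
    qed
    also have "\<dots> = (\<Prod>c\<in>C. \<Prod>i=0..<n. if c \<in> {f i..<b i} then y c else 1)"
      by (rule prod.swap)
    also have "\<dots> = (\<Prod>c\<in>C. y c ^ (card {i. i < n \<and> f i \<le> c} - card {i. i < n \<and> b i \<le> c}))"
    proof (rule prod.cong[OF refl])
      fix c
      have "(\<Prod>i=0..<n. if c \<in> {f i..<b i} then y c else 1) = y c ^ card {i \<in> {0..<n}. c \<in> {f i..<b i}}"
        by (subst prod.inter_filter[symmetric]) auto
      also have "{i \<in> {0..<n}. c \<in> {f i..<b i}} = {i. i < n \<and> f i \<le> c} - {i. i < n \<and> b i \<le> c}"
        by auto
      also have "card \<dots> = card {i. i < n \<and> f i \<le> c} - card {i. i < n \<and> b i \<le> c}"
        by (rule card_Diff_subset) (use f(1) in force)+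
      finally show "(\<Prod>i=0..<n. if c \<in> {f i..<b i} then y c else 1) =
          y c ^ (card {i. i < n \<and> f i \<le> c} - card {i. i < n \<and> b i \<le> c})" .
    qed
    finally show ?thesis .
  qed
  have "card {i. i < n \<and> a (p i) \<le> c} = card {i. i < n \<and> a i \<le> c}" for c
  proof (rule bij_betw_same_card[of p])
    have "p ` {i. i < n \<and> a (p i) \<le> c} = {i. i < n \<and> a i \<le> c}"
    proof (intro equalityI subsetI)
      fix i
      assume i: "i \<in> {i. i < n \<and> a i \<le> c}"
      obtain k where k: "i = p k"
        using permutes_surj[OF p] by (metis surj_def)
      then have "k < n"
        using i permutes_in_image[OF p, of k] by simp
      with i k show "i \<in> p ` {i. i < n \<and> a (p i) \<le> c}"
        by auto
    qed (use permutes_in_image[OF p] in auto)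
    then show "bij_betw p {i. i < n \<and> a (p i) \<le> c} {i. i < n \<and> a i \<le> c}"
      using permutes_inj[OF p] by (auto simp: bij_betw_def intro: inj_on_subset)
  qed
  then show ?thesis
    using ab by (subst (1 2) expand) (auto simp: C_def)
qed

lemma prod_ferrers_contents:
  fixes y :: "int \<Rightarrow> 'a::comm_monoid_mult"
  shows "(\<Prod>w\<in>ferrers \<mu>. y (cell_content w)) =
     (\<Prod>i=0..<length \<mu>. \<Prod>c\<in>{- int i..<int (\<mu> ! i) - int i}. y c)"
proof -
  have "(\<Prod>i=0..<length \<mu>. \<Prod>c\<in>{- int i..<int (\<mu> ! i) - int i}. y c) =
      (\<Prod>(i, c)\<in>(SIGMA i:{0..<length \<mu>}. {- int i..<int (\<mu> ! i) - int i}). y c)"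
    by (rule prod.Sigma) auto
  also have "\<dots> = (\<Prod>w\<in>ferrers \<mu>. y (cell_content w))"
    by (rule prod.reindex_bij_witness[where
          i = "\<lambda>(r, j). (r - 1, int j - int r)" and j = "\<lambda>(i, c). (Suc i, nat (c + int i + 1))"])
       (auto simp: ferrers_def cell_content_def)
  finally show ?thesis ..
qed

text \<open>Row \<open>i\<close> of the Ferrers graph, counted from \<open>0\<close>, has the contents \<open>-i, \<dots>, \<mu>\<^sub>i - i - 1\<close>. In the term of a
  permutation \<open>p\<close>, either some \<open>h\<close> has a negative index and both sides vanish, or all intervals
  \<open>{-p(i)..<\<mu>\<^sub>i - i}\<close> run in the right direction and can be exchanged for these contents.\<close>

lemma content_product_schur:
  fixes y :: "int \<Rightarrow> 'a::comm_rat_algebra"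
  shows "(\<Prod>w\<in>ferrers \<mu>. y (cell_content w)) * schur \<mu> q =
     pluecker (\<lambda>m j. complete_sym q (m + int j) * (\<Prod>c\<in>{- int j..<m}. y c)) \<mu>"
proof -
  let ?L = "length \<mu>"
  let ?h = "\<lambda>i j. complete_sym q (int (\<mu> ! i) - int i + int j)"
  let ?Y = "\<lambda>i j. \<Prod>c\<in>{- int j..<int (\<mu> ! i) - int i}. y c"
  have "(\<Prod>w\<in>ferrers \<mu>. y (cell_content w)) * (\<Prod>i=0..<?L. ?h i (p i)) = (\<Prod>i=0..<?L. ?h i (p i) * ?Y i (p i))"
    if p: "p permutes {0..<?L}" for p
  proof (cases "\<exists>i<?L. int (\<mu> ! i) - int i + int (p i) < 0")
    case True
    then obtain i where "i < ?L" "?h i (p i) = 0"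
      by auto
    then have "(\<Prod>i=0..<?L. ?h i (p i)) = 0" "(\<Prod>i=0..<?L. ?h i (p i) * ?Y i (p i)) = 0"
      by (auto intro!: prod_zero bexI[of _ i])
    then show ?thesis
      by simp
  next
    case False
    then have "(\<Prod>i=0..<?L. ?Y i (p i)) = (\<Prod>i=0..<?L. ?Y i i)"
      using prod_intervals_permute[OF p, of "\<lambda>i. - int i" "\<lambda>i. int (\<mu> ! i) - int i" y] by force
    then show ?thesis
      by (simp add: prod_ferrers_contents prod.distrib mult.commute)
  qed
  then show ?thesis
    unfolding schur_def pluecker_def det_def'[OF mat_carrier] sum_distrib_left
    by (intro sum.cong[OF refl]) (auto simp: mult.left_commute permutes_in_image intro!: arg_cong2[of _ _ _ _ "(*)"])
qed

theorem theorem2p3: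
  shows "kp_solution
    (mps_log (mps_sum
      (\<lambda>\<mu>. mps_const ((\<Prod>w\<in>ferrers \<mu>. yvar (cell_content w)) * schur \<mu> qvar) * schur \<mu> pvar)
      {\<mu>. is_partition \<mu>}))"
  unfolding content_product_schur by (rule kp_solution_log_pluecker_series) auto

end
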